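(* For every $n\geq1$, $\Phi_1$ is a bijection from $\mathcal{T}_n$ to the set of permutations of $\{1,\ldots,n\}$. Moreover, if $\sigma=\Phi_1(T)$, then $cr(T)$ equals the number of occurrences of the pattern 2-31 in $\sigma$.
   Context: A Ferrers diagram is a finite set of unit cells of $\mathbb{Z}^2$ forming left-justified rows whose lengths weakly decrease from top to bottom, considered up to translation; its boundary edges are the unit edges on its Southeast border path. A tree-like tableau is a Ferrers diagram in which each cell is empty or pointed, such that: (1) the top-left cell is pointed; (2) every non-root pointed cell has either a pointed cell above it in its column or a pointed cell to its left in its row, but not both; (3) every row and column contains a pointed cell. Its size $n$ is its number of points (half-perimeter minus 1); $\mathcal{T}_n$ is the set of those of size $n$; the boundary edges of $T\in\mathcal{T}_n$ are labelled $e_0(T),\ldots,e_n(T)$ from Southwest to Northeast. A crossing is an empty cell with a pointed cell above it in its column and a pointed cell to its left in its row; $cr(T)$ is their number. The special point of $T$ is the rightmost among pointed cells that are lowest in their column. $\mathrm{Insertpoint}(T,e)$: let $T'$ be obtained by inserting at $e$ a column (if $e$ is the right end of a row $r$: add a cell at the end of $r$ and every row above) or a row (if $e$ is the bottom of a column $c$: add a cell at the bottom of $c$ and every column to its left), with only the lowest cell of the new column (resp. rightmost cell of the new row) pointed. If $e$ lies Northeast of the special point of $T$ along the border path, the result is $T'$; otherwise add the ribbon of empty cells (connected, no $2\times2$ square, keeping a Ferrers diagram) from the cell immediately right of the new point to the cell immediately below the special point of $T$ (nothing if $e$ is the bottom edge of the special cell). Each $T\in\mathcal{T}_n$ has a unique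 insertion history $T_1,\ldots,T_n=T$ with $T_1$ the unique tableau of size 1 and $T_i=\mathrm{Insertpoint}(T_{i-1},e^i)$. Define $a_1(T)=0$ and, for $2\le i\le n$, $a_i(T)=j$ where $T_i=\mathrm{Insertpoint}(T_{i-1},e_j(T_{i-1}))$; thus $0\le a_i(T)\le i-1$. $\Phi_1(T)=\sigma$ is defined by: for $i=n,n-1,\ldots,1$, write $\{1,\ldots,n\}\setminus\{\sigma(i+1),\ldots,\sigma(n)\}=\{x_0<x_1<\cdots<x_{i-1}\}$ and set $\sigma(i)=x_{a_i(T)}$. An occurrence of 2-31 in a permutation $\sigma$ of $\{1,\ldots,n\}$ is a pair $(i,j)$ with $1\le i<j<n$ and $\sigma(j+1)<\sigma(i)<\sigma(j)$. *)

theory Defs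
  imports Complex_Main "HOL-Combinatorics.Permutations"
begin

text \<open>A cell is a pair (row, column). Rows are numbered downwards and columns rightwards, and
  Ferrers diagrams are normalised by translation so that their top-left cell is \<open>(0,0)\<close>.\<close>

type_synonym cell = "nat \<times> nat"

definition ferrers :: "cell set \<Rightarrow> bool" where
  "ferrers F \<longleftrightarrow> finite F \<and> (\<exists>l :: nat \<Rightarrow> nat. antimono l \<and> F = {(i, j). j < l i})"

definition row_len :: "cell set \<Rightarrow> nat \<Rightarrow> nat" where
  "row_len F i = card {j. (i, j) \<in> F}"

definition col_len :: "cell set \<Rightarrow> nat \<Rightarrow> nat" where
  "col_len F j = card {i. (i, j) \<in> F}"

definition num_rows :: "cell set \<Rightarrow> nat" where
  "num_rows F = card (fst ` F)"

record tableau =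
  cells :: "cell set"
  points :: "cell set"

definition point_above :: "tableau \<Rightarrow> cell \<Rightarrow> bool" where
  "point_above T p \<longleftrightarrow> (\<exists>i < fst p. (i, snd p) \<in> points T)"

definition point_left :: "tableau \<Rightarrow> cell \<Rightarrow> bool" where
  "point_left T p \<longleftrightarrow> (\<exists>j < snd p. (fst p, j) \<in> points T)"

definition tree_like :: "tableau \<Rightarrow> bool" where
  "tree_like T \<longleftrightarrow>
     ferrers (cells T) \<and> points T \<subseteq> cells T \<and>
     (0, 0) \<in> points T \<and>
     (\<forall>p \<in> points T - {(0, 0)}. point_above T p \<noteq> point_left T p) \<and>
     (\<forall>i \<in> fst ` cells T. \<exists>j. (i, j) \<in> points T) \<and>
     (\<forall>j \<in> snd ` cells T. \<exists>i. (i, j) \<in> points T)"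

definition tsize :: "tableau \<Rightarrow> nat" where
  "tsize T = card (points T)"

definition TLT :: "nat \<Rightarrow> tableau set" where
  "TLT n = {T. tree_like T \<and> tsize T = n}"

definition crossings :: "tableau \<Rightarrow> cell set" where
  "crossings T = {p \<in> cells T - points T. point_above T p \<and> point_left T p}"

definition cr :: "tableau \<Rightarrow> nat" where
  "cr T = card (crossings T)"

text \<open>Every boundary edge is either the right end of a row or the bottom of a column. The list
  \<open>boundary F\<close> follows the border path from Southwest to Northeast: going through the rows from
  bottom to top, it visits the bottoms of those columns whose lowest cell is in the current row,
  and then the right end of that row. Thus \<open>e\<^sub>j(T)\<close> is \<open>boundary (cells T) ! j\<close>.\<close>

datatype edge = Row_End nat | Col_Bottom nat

definition boundary :: "cell set \<Rightarrow> edge list" where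
  "boundary F =
     concat (map (\<lambda>i. map Col_Bottom [row_len F (Suc i) ..< row_len F i] @ [Row_End i])
                 (rev [0 ..< num_rows F]))"

definition northeast_of :: "cell set \<Rightarrow> edge \<Rightarrow> edge \<Rightarrow> bool" where
  "northeast_of F e e' \<longleftrightarrow>
     (\<exists>i j. i < j \<and> j < length (boundary F) \<and> boundary F ! i = e' \<and> boundary F ! j = e)"

text \<open>Lowest in its column means that the cell below is not in the diagram. There is at most one
  such cell in each column, so the rightmost one is unique.\<close>

definition special :: "tableau \<Rightarrow> cell" where
  "special T = (ARG_MAX snd p. p \<in> points T \<and> (Suc (fst p), snd p) \<notin> cells T)"

text \<open>Inserting a column at the right end of row \<open>i\<close> puts it at position \<open>row_len F i\<close>: the columns
  from this position on move to the right, so that each of the rows \<open>0, \<dots>, i\<close> gets longer by one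
  cell. Inserting a row at the bottom of a column is the transposed operation. The map
  \<open>shift_cell F e\<close> gives the new position of an old cell.\<close>

definition bump :: "nat \<Rightarrow> nat \<Rightarrow> nat" where
  "bump k x = (if x < k then x else Suc x)"

fun shift_cell :: "cell set \<Rightarrow> edge \<Rightarrow> cell \<Rightarrow> cell" where
  "shift_cell F (Row_End r) (i, j) = (i, bump (row_len F r) j)"
| "shift_cell F (Col_Bottom c) (i, j) = (bump (col_len F c) i, j)"

fun new_cells :: "cell set \<Rightarrow> edge \<Rightarrow> cell set" where
  "new_cells F (Row_End r) = {0..r} \<times> {row_len F r}"
| "new_cells F (Col_Bottom c) = {col_len F c} \<times> {0..c}"

fun new_point :: "cell set \<Rightarrow> edge \<Rightarrow> cell" where
  "new_point F (Row_End r) = (r, row_len F r)"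
| "new_point F (Col_Bottom c) = (col_len F c, c)"

definition insert_line :: "tableau \<Rightarrow> edge \<Rightarrow> tableau" where
  "insert_line T e =
     \<lparr>cells = shift_cell (cells T) e ` cells T \<union> new_cells (cells T) e,
      points = insert (new_point (cells T) e) (shift_cell (cells T) e ` points T)\<rparr>"

definition adjacent :: "cell \<Rightarrow> cell \<Rightarrow> bool" where
  "adjacent p q \<longleftrightarrow>
     (fst p = fst q \<and> (snd q = Suc (snd p) \<or> snd p = Suc (snd q))) \<or>
     (snd p = snd q \<and> (fst q = Suc (fst p) \<or> fst p = Suc (fst q)))"

definition connected_cells :: "cell set \<Rightarrow> bool" where
  "connected_cells B \<longleftrightarrow>
     (\<forall>p \<in> B. \<forall>q \<in> B. (p, q) \<in> {(x, y). x \<in> B \<and> y \<in> B \<and> adjacent x y}\<^sup>*)"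

text \<open>\<open>B\<close> is a ribbon that can be added to \<open>F\<close> and that goes from its Southwest end \<open>a\<close> to its
  Northeast end \<open>b\<close>.\<close>

definition is_ribbon :: "cell set \<Rightarrow> cell \<Rightarrow> cell \<Rightarrow> cell set \<Rightarrow> bool" where
  "is_ribbon F a b B \<longleftrightarrow>
     a \<in> B \<and> b \<in> B \<and> B \<subseteq> {fst b..fst a} \<times> {snd a..snd b} \<and>
     B \<inter> F = {} \<and> ferrers (F \<union> B) \<and> connected_cells B \<and>
     (\<nexists>i j. {i, Suc i} \<times> {j, Suc j} \<subseteq> B)"

definition ribbon :: "cell set \<Rightarrow> cell \<Rightarrow> cell \<Rightarrow> cell set" where
  "ribbon F a b = (THE B. is_ribbon F a b B)"

text \<open>The ribbon ends just below the special point of \<open>T\<close>, which may have been moved by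
  the insertion of a column.\<close>

definition Insertpoint :: "tableau \<Rightarrow> edge \<Rightarrow> tableau" where
  "Insertpoint T e =
     (let T' = insert_line T e;
          (i, j) = new_point (cells T) e;
          (k, l) = shift_cell (cells T) e (special T)
      in if northeast_of (cells T) e (Col_Bottom (snd (special T)))
            \<or> e = Col_Bottom (snd (special T))
         then T'
         else T'\<lparr>cells := cells T' \<union> ribbon (cells T') (i, Suc j) (Suc k, l)\<rparr>)"

definition unit_tableau :: tableau where
  "unit_tableau = \<lparr>cells = {(0, 0)}, points = {(0, 0)}\<rparr>"

text \<open>A history is the list of \<open>T\<^sub>1, \<dots>, T\<^sub>n\<close>, so that \<open>T\<^sub>i\<close> is its entry of index \<open>i - 1\<close>.\<close>

definition is_history :: "tableau \<Rightarrow> tableau list \<Rightarrow> bool" where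
  "is_history T Ts \<longleftrightarrow>
     length Ts = tsize T \<and> Ts \<noteq> [] \<and> hd Ts = unit_tableau \<and> last Ts = T \<and>
     (\<forall>k. Suc k < length Ts \<longrightarrow>
        (\<exists>e \<in> set (boundary (cells (Ts ! k))). Ts ! Suc k = Insertpoint (Ts ! k) e))"

definition history :: "tableau \<Rightarrow> tableau list" where
  "history T = (THE Ts. is_history T Ts)"

definition hist :: "tableau \<Rightarrow> nat \<Rightarrow> tableau" where
  "hist T i = history T ! (i - 1)"

definition ins_index :: "tableau \<Rightarrow> nat \<Rightarrow> nat" where
  "ins_index T i =
     (if i = 1 then 0
      else THE j. j < length (boundary (cells (hist T (i - 1)))) \<and>
             hist T i = Insertpoint (hist T (i - 1)) (boundary (cells (hist T (i - 1))) ! j))"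

text \<open>The permutation of \<open>{1..n}\<close> whose values are computed for \<open>i = n, \<dots>, 1\<close>, \<open>a i\<close> being the
  rank (from 0) of \<open>\<sigma>(i)\<close> among the values that are still unused. It is extended by the identity,
  as required by \<open>permutes\<close>.\<close>

function perm_of_code :: "nat \<Rightarrow> (nat \<Rightarrow> nat) \<Rightarrow> nat \<Rightarrow> nat" where
  "perm_of_code n a i =
     (if i \<in> {1..n}
      then sorted_list_of_set ({1..n} - perm_of_code n a ` {i<..n}) ! a i
      else i)"
  by pat_completeness auto
termination
  by (relation "measure (\<lambda>(n, a, i). n - i)") auto

declare perm_of_code.simps [simp del]

definition Phi1 :: "tableau \<Rightarrow> nat \<Rightarrow> nat" where
  "Phi1 T = perm_of_code (tsize T) (ins_index T)"

definition occ_2_31 :: "nat \<Rightarrow> (nat \<Rightarrow> nat) \<Rightarrow> (nat \<times> nat) set" where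
  "occ_2_31 n \<sigma> =
     {(i, j). 1 \<le> i \<and> i < j \<and> j < n \<and> \<sigma> (j + 1) < \<sigma> i \<and> \<sigma> i < \<sigma> j}"

end

theory Submission
  imports Defs
begin

text \<open>Write \<open>j - i\<close> for the content of the cell \<open>(i, j)\<close>. The edges of the border path have consecutive
  contents, and so do the cells of a ribbon, which is the set of the first cells outside the diagram
  on the diagonals from its Southwest to its Northeast end. After an insertion at \<open>e\<^sub>j\<close> the special
  point is the new point, and the bottom of its column is again the edge with index \<open>j\<close>. So the
  special point gives back the ribbon and the inserted line, every tableau of size \<open>n + 1\<close> arises
  exactly once by insertion from one of size \<open>n\<close>, and the codes \<open>a\<^sub>1, \<dots>, a\<^sub>n\<close> with \<open>a\<^sub>i < i\<close>
  parametrise the tableaux. The crossings created by an insertion are exactly the cells of the ribbon,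
  so \<open>cr\<close> is the sum of the truncated differences \<open>a\<^sub>i - a\<^sub>i\<^sub>+\<^sub>1\<close>. On the permutation side
  \<open>a\<^sub>i\<close> counts the \<open>k < i\<close> with \<open>\<sigma>(k) < \<sigma>(i)\<close>, and the same truncated difference counts the
  occurrences of 2-31 whose 31 is at positions \<open>i\<close> and \<open>i + 1\<close>.\<close>

section \<open>Ferrers diagrams and ribbons\<close>

text \<open>The obstacle is inversion: a finished tableau does not mark which of its empty cells
  form the last ribbon. Its special point tells where the ribbon starts; the end is found on the
  inner rim, that is, among the last cells of the diagram on their diagonals. The ribbon covers no
  point, and the rim cell that follows it is the old special point. So the ribbon stops just below
  the first rim point met on the way Northeast. Contents turn lengths into arithmetic: a ribbon from
  the right of \<open>p\<close> to below \<open>q\<close> has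
  \<open>content q - content p - 1\<close> cells, and the bottom edge below a special point
  \<open>q\<close> has index \<open>content q\<close> plus the number of rows minus 1. Insertion of
  a row is transposed insertion of a column, except for the special point: its definition favours
  columns, so it needs a separate argument for rows. Surjectivity of \<open>Phi1\<close> is not
  proved by building a tableau from a code: both sides have \<open>fact n\<close> elements, so
  injectivity suffices.\<close>

lemma finite_down_set_nat:
  fixes A :: "nat set"
  assumes "finite A" "\<And>x y. x \<in> A \<Longrightarrow> y \<le> x \<Longrightarrow> y \<in> A"
  shows "A = {..<card A}"
proof (cases "A = {}")
  case False
  have "A = {..Max A}"
    using assms False by (auto intro: Max_ge assms(2)[OF Max_in])
  then have "card A = Suc (Max A)"
    by (metis card_atMost)
  then show ?thesis
    using \<open>A = {..Max A}\<close> lessThan_Suc_atMost by auto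
qed simp

lemma ferrers_down:
  assumes "ferrers F" "(i, j) \<in> F" "i' \<le> i" "j' \<le> j"
  shows "(i', j') \<in> F"
proof -
  obtain l where l: "antimono l" "F = {(i, j). j < l i}"
    using assms(1) unfolding ferrers_def by auto
  have "l i \<le> l i'"
    using l(1) assms(3) by (simp add: antimono_def)
  then show ?thesis
    using assms l(2) by auto
qed

lemma ferrers_finite: "ferrers F \<Longrightarrow> finite F"
  by (simp add: ferrers_def)

lemma ferrersI:
  assumes fin: "finite F"
    and down: "\<And>i j i' j'. (i, j) \<in> F \<Longrightarrow> i' \<le> i \<Longrightarrow> j' \<le> j \<Longrightarrow> (i', j') \<in> F"
  shows "ferrers F"
proof -
  define l where "l i = card {j. (i, j) \<in> F}" for i
  have fin': "finite {j. (i, j) \<in> F}" for i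
    by (rule finite_subset[of _ "snd ` F"]) (use fin in force)+
  have row: "{j. (i, j) \<in> F} = {..<l i}" for i
    unfolding l_def by (rule finite_down_set_nat[OF fin']) (use down in blast)
  have "antimono l"
    unfolding antimono_def
  proof (intro allI impI)
    fix x y :: nat
    assume "x \<le> y"
    then have "{j. (y, j) \<in> F} \<subseteq> {j. (x, j) \<in> F}"
      using down by blast
    then show "l y \<le> l x"
      unfolding l_def using fin' card_mono by blast
  qed
  moreover have "F = {(i, j). j < l i}"
    using row by blast
  ultimately show ?thesis
    unfolding ferrers_def using fin by blast
qed

lemma ferrersI_step:
  assumes fin: "finite F"
    and up: "\<And>i j. (Suc i, j) \<in> F \<Longrightarrow> (i, j) \<in> F"
    and left: "\<And>i j. (i, Suc j) \<in> F \<Longrightarrow> (i, j) \<in> F"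
  shows "ferrers F"
proof (rule ferrersI[OF fin])
  have up': "(i + d, j) \<in> F \<Longrightarrow> (i, j) \<in> F" for i j d
    by (induction d) (auto dest: up)
  have left': "(i, j + d) \<in> F \<Longrightarrow> (i, j) \<in> F" for i j d
    by (induction d) (auto dest: left)
  show "(i', j') \<in> F" if "(i, j) \<in> F" "i' \<le> i" "j' \<le> j" for i j i' j'
    using that up'[of i' "i - i'" j] left'[of i' j' "j - j'"] by simp
qed

lemma mem_row_len:
  assumes "ferrers F"
  shows "(i, j) \<in> F \<longleftrightarrow> j < row_len F i"
proof -
  have "finite {j. (i, j) \<in> F}"
    by (rule finite_subset[of _ "snd ` F"]) (use ferrers_finite[OF assms] in force)+
  then have "{j. (i, j) \<in> F} = {..<row_len F i}"
    unfolding row_len_def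
    by (rule finite_down_set_nat) (use ferrers_down[OF assms] in blast)
  then show ?thesis
    by blast
qed

lemma mem_col_len:
  assumes "ferrers F"
  shows "(i, j) \<in> F \<longleftrightarrow> i < col_len F j"
proof -
  have "finite {i. (i, j) \<in> F}"
    by (rule finite_subset[of _ "fst ` F"]) (use ferrers_finite[OF assms] in force)+
  then have "{i. (i, j) \<in> F} = {..<col_len F j}"
    unfolding col_len_def
    by (rule finite_down_set_nat) (use ferrers_down[OF assms] in blast)
  then show ?thesis
    by blast
qed

lemma num_rows_col_len:
  assumes "ferrers F"
  shows "num_rows F = col_len F 0"
proof -
  have "fst ` F = {i. (i, 0) \<in> F}"
    using ferrers_down[OF assms] by force
  then show ?thesis
    by (simp add: num_rows_def col_len_def)
qed

lemma row_len_eqI: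
  assumes "\<And>j. (i, j) \<in> F \<longleftrightarrow> j < n"
  shows "row_len F i = n"
proof -
  have "{j. (i, j) \<in> F} = {..<n}"
    using assms by blast
  then show ?thesis
    by (simp add: row_len_def)
qed

section \<open>Diagonals and the strip of cells just outside a diagram\<close>

definition content :: "cell \<Rightarrow> int" where
  "content p = int (snd p) - int (fst p)"

lemma content_Pair [simp]: "content (i, j) = int j - int i"
  by (simp add: content_def)

text \<open>On a diagonal that misses \<open>F\<close> the first outside cell is on an axis; the
  alternatives \<open>i = 0\<close> and \<open>j = 0\<close> include it, so that for a Ferrers
  diagram every diagonal contributes exactly one cell and the strip is infinite in both
  directions.\<close>

definition outer_strip :: "cell set \<Rightarrow> cell set" where
  "outer_strip F = {(i, j). (i, j) \<notin> F \<and> (i = 0 \<or> j = 0 \<or> (i - 1, j - 1) \<in> F)}"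

definition strip :: "cell set \<Rightarrow> cell \<Rightarrow> cell \<Rightarrow> cell set" where
  "strip F a b = {p \<in> outer_strip F. content a \<le> content p \<and> content p \<le> content b}"

text \<open>Of two cells on one diagonal, the farther one has its diagonal predecessor in
  \<open>F\<close>, and this predecessor is weakly Southeast of the nearer cell, which would then be
  in \<open>F\<close> too.\<close>

lemma outer_strip_unique:
  assumes F: "ferrers F" and "p \<in> outer_strip F" "q \<in> outer_strip F" "content p = content q"
  shows "p = q"
proof -
  have *: "\<not> fst p < fst q"
    if "p \<in> outer_strip F" "q \<in> outer_strip F" "content p = content q" for p q
  proof
    assume less: "fst p < fst q"
    obtain i j i' j' where pq: "p = (i, j)" "q = (i', j')"
      by fastforce
    have "i \<le> i' - 1" "j \<le> j' - 1" "i' \<noteq> 0" "j' \<noteq> 0"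
      using less that(3) pq by auto
    then show False
      using ferrers_down[OF F, of "i' - 1" "j' - 1" i j] that(1,2) pq
      by (auto simp: outer_strip_def)
  qed
  have "fst p = fst q"
    using *[of p q] *[of q p] assms by simp
  with assms(4) show ?thesis
    by (simp add: content_def prod_eq_iff)
qed

text \<open>Going Northeast along the strip means moving right if the cell above is in
  \<open>F\<close> or the row is the top one, and moving up otherwise.\<close>

lemma outer_strip_step:
  assumes F: "ferrers F" and p: "p \<in> outer_strip F"
  obtains q where "q \<in> outer_strip F" "content q = content p + 1" "adjacent p q"
    "fst q \<le> fst p" "snd p \<le> snd q"
proof -
  obtain i j where ij: "p = (i, j)"
    by fastforce
  have pF: "(i, j) \<notin> F" "i = 0 \<or> j = 0 \<or> (i - 1, j - 1) \<in> F"
    using p ij by (auto simp: outer_strip_def)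
  have right: "(i, Suc j) \<notin> F"
    using ferrers_down[OF F, of i "Suc j" i j] pF by auto
  consider (right) "i = 0 \<or> (i - 1, j) \<in> F" | (up) "i > 0" "(i - 1, j) \<notin> F"
    by auto
  then show ?thesis
  proof cases
    case right
    then show ?thesis
      using that[of "(i, Suc j)"] \<open>(i, Suc j) \<notin> F\<close> ij
      by (auto simp: outer_strip_def adjacent_def)
  next
    case up
    have "(i - 1 - 1, j - 1) \<in> F" if "(i - 1, j - 1) \<in> F"
      by (rule ferrers_down[OF F that]) auto
    then have "i - 1 = 0 \<or> j = 0 \<or> (i - 1 - 1, j - 1) \<in> F"
      using pF up by auto
    then show ?thesis
      using that[of "(i - 1, j)"] up ij
      by (auto simp: outer_strip_def adjacent_def)
  qed
qed

text \<open>One induction along the strip yields existence at every larger content, monotone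
  coordinates and, as long as the content does not exceed that of \<open>b\<close>, a path inside
  the strip. The cell \<open>b\<close> serves only as a bound.\<close>

lemma outer_strip_path:
  assumes F: "ferrers F" and a: "a \<in> outer_strip F"
  shows "\<exists>q \<in> outer_strip F. content q = content a + int n \<and> fst q \<le> fst a \<and> snd a \<le> snd q \<and>
    (content a + int n \<le> content b \<longrightarrow>
       (a, q) \<in> {(x, y). x \<in> strip F a b \<and> y \<in> strip F a b \<and> adjacent x y}\<^sup>*)"
    (is "\<exists>q \<in> _. ?P n q")
proof (induction n)
  case 0
  then show ?case
    using a by (intro bexI[of _ a]) auto
next
  case (Suc n)
  then obtain q where q: "q \<in> outer_strip F" "?P n q"
    by blast
  obtain q' where q': "q' \<in> outer_strip F" "content q' = content q + 1" "adjacent q q'"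
    "fst q' \<le> fst q" "snd q \<le> snd q'"
    using outer_strip_step[OF F q(1)] .
  have "?P (Suc n) q'"
  proof (intro conjI impI)
    assume le: "content a + int (Suc n) \<le> content b"
    then have "(a, q) \<in> {(x, y). x \<in> strip F a b \<and> y \<in> strip F a b \<and> adjacent x y}\<^sup>*"
      using q by auto
    moreover have "q \<in> strip F a b" "q' \<in> strip F a b"
      using q q' le by (auto simp: strip_def)
    ultimately show "(a, q') \<in> {(x, y). x \<in> strip F a b \<and> y \<in> strip F a b \<and> adjacent x y}\<^sup>*"
      using q'(3) by (auto intro: rtrancl_into_rtrancl)
  qed (use q q' in auto)
  with q'(1) show ?case
    by blast
qed

lemma outer_strip_at_content:
  assumes F: "ferrers F" and a: "a \<in> outer_strip F" and "content a \<le> d"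
  obtains q where "q \<in> outer_strip F" "content q = d" "fst q \<le> fst a" "snd a \<le> snd q"
  \<comment> \<open>The path is not wanted here, so its bound may be any cell.\<close>
  using outer_strip_path[OF F a, of "nat (d - content a)" undefined] assms(3) that
  by (metis add.commute diff_add_cancel int_nat_eq diff_ge_0_iff_ge)

lemma outer_strip_mono:
  assumes F: "ferrers F" and "p \<in> outer_strip F" "q \<in> outer_strip F" "content p \<le> content q"
  shows "fst q \<le> fst p" "snd p \<le> snd q"
  using outer_strip_at_content[OF F assms(2) assms(4)] outer_strip_unique[OF F _ assms(3)] by metis+

lemma strip_connected:
  assumes F: "ferrers F" and a: "a \<in> outer_strip F"
  shows "connected_cells (strip F a b)"
proof -
  let ?R = "{(x, y). x \<in> strip F a b \<and> y \<in> strip F a b \<and> adjacent x y}"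
  have from_a: "(a, p) \<in> ?R\<^sup>*" if p: "p \<in> strip F a b" for p
  proof -
    have le: "content a \<le> content p" "content p \<le> content b" "p \<in> outer_strip F"
      using p by (auto simp: strip_def)
    obtain q where q: "q \<in> outer_strip F" "content q = content p" "(a, q) \<in> ?R\<^sup>*"
      using outer_strip_path[OF F a, of "nat (content p - content a)" b] le by auto
    then show ?thesis
      using outer_strip_unique[OF F q(1) le(3)] by simp
  qed
  have "sym ?R"
    by (auto simp: sym_def adjacent_def)
  then have "sym (?R\<^sup>*)"
    by (rule sym_rtrancl)
  then show ?thesis
    unfolding connected_cells_def using from_a by (meson rtrancl_trans symD)
qed

lemma strip_content_bij:
  assumes F: "ferrers F" and a: "a \<in> outer_strip F"
  shows "bij_betw content (strip F a b) {content a..content b}"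
  unfolding bij_betw_def
proof
  show "inj_on content (strip F a b)"
    using outer_strip_unique[OF F] by (auto simp: inj_on_def strip_def)
  show "content ` strip F a b = {content a..content b}"
  proof
    show "{content a..content b} \<subseteq> content ` strip F a b"
    proof
      fix d assume d: "d \<in> {content a..content b}"
      then obtain q where "q \<in> outer_strip F" "content q = d"
        using outer_strip_at_content[OF F a, of d] by (metis atLeastAtMost_iff)
      with d show "d \<in> content ` strip F a b"
        by (auto simp: strip_def)
    qed
  qed (auto simp: strip_def)
qed

lemma finite_strip:
  assumes "ferrers F" "a \<in> outer_strip F"
  shows "finite (strip F a b)"
  using bij_betw_finite[OF strip_content_bij[OF assms]] by simp

lemma card_strip:
  assumes "ferrers F" "a \<in> outer_strip F"
  shows "card (strip F a b) = nat (content b - content a + 1)"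
  using bij_betw_same_card[OF strip_content_bij[OF assms, of b]] by simp

text \<open>The upper and left neighbours of a strip cell are in \<open>F\<close> or are the
  neighbouring cells of the outer strip. They could fail to be in the union only beyond the two
  ends, and there they are \<open>(k, l)\<close> and \<open>(i, j)\<close>, which lie in
  \<open>F\<close> by assumption.\<close>

lemma ferrers_Un_strip:
  assumes F: "ferrers F" and a: "(i, Suc j) \<in> outer_strip F" and b: "(Suc k, l) \<in> outer_strip F"
    and "(i, j) \<in> F" "(k, l) \<in> F"
  shows "ferrers (F \<union> strip F (i, Suc j) (Suc k, l))" (is "ferrers (F \<union> ?B)")
proof (rule ferrersI_step)
  show "finite (F \<union> ?B)"
    using ferrers_finite[OF F] finite_strip[OF F a] by simp
next
  fix x y
  assume "(Suc x, y) \<in> F \<union> ?B"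
  then consider "(Suc x, y) \<in> F" | "(Suc x, y) \<in> ?B"
    by blast
  then show "(x, y) \<in> F \<union> ?B"
  proof cases
    case 1
    then show ?thesis
      using ferrers_down[OF F, of "Suc x" y x y] by simp
  next
    case 2
    then have B: "(Suc x, y) \<in> outer_strip F" "int (Suc j) - int i \<le> int y - int (Suc x)"
      "int y - int (Suc x) \<le> int l - int (Suc k)"
      by (auto simp: strip_def)
    show ?thesis
    proof (cases "(x, y) \<in> F")
      case False
      have "x = 0 \<or> y = 0 \<or> (x - 1, y - 1) \<in> F"
        using B(1) ferrers_down[OF F, of x "y - 1" "x - 1" "y - 1"] by (auto simp: outer_strip_def)
      with False have "(x, y) \<in> outer_strip F"
        by (simp add: outer_strip_def)
      moreover have "int y - int (Suc x) \<noteq> int l - int (Suc k)"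
        using outer_strip_unique[OF F B(1) b] False assms(5) by auto
      ultimately show ?thesis
        using B by (auto simp: strip_def)
    qed simp
  qed
next
  fix x y
  assume "(x, Suc y) \<in> F \<union> ?B"
  then consider "(x, Suc y) \<in> F" | "(x, Suc y) \<in> ?B"
    by blast
  then show "(x, y) \<in> F \<union> ?B"
  proof cases
    case 1
    then show ?thesis
      using ferrers_down[OF F, of x "Suc y" x y] by simp
  next
    case 2
    then have B: "(x, Suc y) \<in> outer_strip F" "int (Suc j) - int i \<le> int (Suc y) - int x"
      "int (Suc y) - int x \<le> int l - int (Suc k)"
      by (auto simp: strip_def)
    show ?thesis
    proof (cases "(x, y) \<in> F")
      case False
      have "x = 0 \<or> y = 0 \<or> (x - 1, y - 1) \<in> F"
        using B(1) ferrers_down[OF F, of "x - 1" y "x - 1" "y - 1"] by (auto simp: outer_strip_def)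
      with False have "(x, y) \<in> outer_strip F"
        by (simp add: outer_strip_def)
      moreover have "int (Suc y) - int x \<noteq> int (Suc j) - int i"
        using outer_strip_unique[OF F B(1) a] False assms(4) by auto
      ultimately show ?thesis
        using B by (auto simp: strip_def)
    qed simp
  qed
qed

lemma adjacent_content: "adjacent p q \<Longrightarrow> \<bar>content q - content p\<bar> = 1"
  by (auto simp: adjacent_def content_def)

text \<open>A discrete intermediate value argument: each step to an adjacent cell changes the
  content by exactly 1.\<close>

lemma connected_contents:
  assumes conn: "connected_cells B" and "p \<in> B" "q \<in> B" "content p \<le> d" "d \<le> content q"
  shows "\<exists>x \<in> B. content x = d"
proof -
  let ?R = "{(x, y). x \<in> B \<and> y \<in> B \<and> adjacent x y}"
  have "(p, q) \<in> ?R\<^sup>*"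
    using assms unfolding connected_cells_def by blast
  then have "\<forall>d. content p \<le> d \<and> d \<le> content q \<longrightarrow> (\<exists>x \<in> B. content x = d)"
  proof induction
    case base
    then show ?case
      using \<open>p \<in> B\<close> by force
  next
    case (step y z)
    show ?case
    proof (intro allI impI)
      fix d assume d: "content p \<le> d \<and> d \<le> content z"
      have "z \<in> B" "adjacent y z"
        using step.hyps by auto
      show "\<exists>x \<in> B. content x = d"
      proof (cases "d = content z")
        case False
        then have "d \<le> content y"
          using adjacent_content[OF \<open>adjacent y z\<close>] d by linarith
        then show ?thesis
          using step.IH d by blast
      qed (use \<open>z \<in> B\<close> in blast)
    qed
  qed
  with assms show ?thesis
    by blast
qed

text \<open>For uniqueness, the absence of squares puts a ribbon inside the outer strip, the
  bounding rectangle confines its contents, and connectedness makes it meet every diagonal between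
  its ends.\<close>

lemma ribbon_eq_strip:
  assumes F: "ferrers F" and a: "(i, Suc j) \<in> outer_strip F" and b: "(Suc k, l) \<in> outer_strip F"
    and ij: "(i, j) \<in> F" and kl: "(k, l) \<in> F"
    and le: "content (i, Suc j) \<le> content (Suc k, l)"
  shows "ribbon F (i, Suc j) (Suc k, l) = strip F (i, Suc j) (Suc k, l)" (is "_ = ?B")
  unfolding ribbon_def
proof (rule the_equality)
  have out: "?B \<subseteq> outer_strip F"
    by (auto simp: strip_def)
  have "?B \<subseteq> {Suc k..i} \<times> {Suc j..l}"
  proof
    fix p assume "p \<in> ?B"
    then show "p \<in> {Suc k..i} \<times> {Suc j..l}"
      using outer_strip_mono[OF F a, of p] outer_strip_mono[OF F _ b, of p]
      by (auto simp: strip_def mem_Times_iff)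
  qed
  moreover have "\<not> {x, Suc x} \<times> {y, Suc y} \<subseteq> ?B" for x y
  proof
    assume "{x, Suc x} \<times> {y, Suc y} \<subseteq> ?B"
    then have "(x, y) \<in> outer_strip F" "(Suc x, Suc y) \<in> outer_strip F"
      using out by auto
    then show False
      using outer_strip_unique[OF F, of "(x, y)" "(Suc x, Suc y)"] by simp
  qed
  moreover have "?B \<inter> F = {}"
    by (auto simp: strip_def outer_strip_def)
  moreover have "(i, Suc j) \<in> ?B" "(Suc k, l) \<in> ?B"
    using a b le by (auto simp: strip_def)
  ultimately show "is_ribbon F (i, Suc j) (Suc k, l) ?B"
    unfolding is_ribbon_def
    using ferrers_Un_strip[OF F a b ij kl] strip_connected[OF F a] by auto
next
  fix B assume "is_ribbon F (i, Suc j) (Suc k, l) B"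
  then have B: "(i, Suc j) \<in> B" "(Suc k, l) \<in> B" "B \<subseteq> {Suc k..i} \<times> {Suc j..l}" "B \<inter> F = {}"
    "ferrers (F \<union> B)" "connected_cells B"
    and sq: "\<And>x y. \<not> {x, Suc x} \<times> {y, Suc y} \<subseteq> B"
    by (auto simp: is_ribbon_def)
  have "B \<subseteq> outer_strip F"
  proof
    fix p assume p: "p \<in> B"
    obtain x y where xy: "p = (x, y)"
      by fastforce
    show "p \<in> outer_strip F"
    proof (rule ccontr)
      assume "p \<notin> outer_strip F"
      with p xy B(4) obtain x' y' where x'y': "x = Suc x'" "y = Suc y'" "(x', y') \<notin> F"
        by (cases x; cases y) (auto simp: outer_strip_def)
      have "(Suc x', Suc y') \<in> F \<union> B"
        using p xy x'y' by simp
      \<comment> \<open>A cell beyond the outer strip would force the whole square at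
        \<open>(x', y')\<close> into the enlarged diagram, and outside \<open>F\<close> because
        \<open>(x', y')\<close> already is.\<close>
      then have "(x', y') \<in> F \<union> B" "(Suc x', y') \<in> F \<union> B" "(x', Suc y') \<in> F \<union> B"
        using ferrers_down[OF B(5)] by (meson le_SucI order_refl)+
      then have "(x', y') \<in> B" "(Suc x', y') \<in> B" "(x', Suc y') \<in> B"
        using ferrers_down[OF F, of "Suc x'" y' x' y'] ferrers_down[OF F, of x' "Suc y'" x' y']
          x'y'(3) by auto
      then show False
        using sq[of x' y'] p xy x'y' by auto
    qed
  qed
  moreover have "content (i, Suc j) \<le> content p \<and> content p \<le> content (Suc k, l)" if "p \<in> B" for p
    using that B(3) by (cases p) auto
  ultimately have sub: "B \<subseteq> ?B"
    by (auto simp: strip_def)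
  moreover have "?B \<subseteq> B"
  proof
    fix p assume p: "p \<in> ?B"
    then obtain x where x: "x \<in> B" "content x = content p"
      using connected_contents[OF B(6,1,2), of "content p"] by (auto simp: strip_def)
    then have "x = p"
      using outer_strip_unique[OF F, of x p] sub p by (auto simp: strip_def)
    with x show "p \<in> B"
      by simp
  qed
  ultimately show "B = ?B"
    by blast
qed

section \<open>Adding and removing the ribbon\<close>

lemma tree_like_ferrers: "tree_like T \<Longrightarrow> ferrers (cells T)"
  by (simp add: tree_like_def)

lemma tree_like_points: "tree_like T \<Longrightarrow> p \<in> points T \<Longrightarrow> p \<in> cells T"
  by (auto simp: tree_like_def)

lemma tree_like_row:
  assumes "tree_like T" "(i, j) \<in> cells T"
  obtains j' where "(i, j') \<in> points T"
proof -
  have "i \<in> fst ` cells T"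
    using assms(2) by (metis fst_conv imageI)
  then show thesis
    using assms(1) that unfolding tree_like_def by blast
qed

lemma tree_like_col:
  assumes "tree_like T" "(i, j) \<in> cells T"
  obtains i' where "(i', j) \<in> points T"
proof -
  have "j \<in> snd ` cells T"
    using assms(2) by (metis snd_conv imageI)
  then show thesis
    using assms(1) that unfolding tree_like_def by blast
qed

lemma tree_like_finite_points: "tree_like T \<Longrightarrow> finite (points T)"
  unfolding tree_like_def using ferrers_finite finite_subset by blast

section \<open>Lowest points and the special point\<close>

definition lowest :: "tableau \<Rightarrow> cell \<Rightarrow> bool" where
  "lowest T p \<longleftrightarrow> p \<in> points T \<and> (Suc (fst p), snd p) \<notin> cells T"

text \<open>This is the situation of the new point after the line is inserted and before the ribbon
  is added.\<close>

definition corner_point :: "tableau \<Rightarrow> cell \<Rightarrow> bool" where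
  "corner_point T p \<longleftrightarrow> lowest T p \<and> (fst p, Suc (snd p)) \<notin> cells T"

lemma lowest_unique:
  assumes T: "tree_like T" and "lowest T p" "lowest T q" "snd p = snd q"
  shows "p = q"
proof -
  note F = tree_like_ferrers[OF T]
  have *: "\<not> fst p < fst q" if "lowest T p" "lowest T q" "snd p = snd q" for p q
    using that ferrers_down[OF F, of "fst q" "snd q" "Suc (fst p)" "snd p"] tree_like_points[OF T, of q]
    by (auto simp: lowest_def)
  show ?thesis
    using *[of p q] *[of q p] assms(2-4) by (simp add: prod_eq_iff)
qed

lemma special_eqI:
  assumes T: "tree_like T" and p: "lowest T p" and max: "\<And>q. lowest T q \<Longrightarrow> snd q \<le> snd p"
  shows "special T = p"
proof -
  have "special T = (ARG_MAX snd p. lowest T p)"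
    by (simp add: special_def lowest_def)
  also have "\<dots> = p"
  proof (rule arg_maxI[where P = "lowest T" and f = snd, OF p])
    show "\<not> snd p < snd q" if "lowest T q" for q
      using max[OF that] by simp
    fix x assume "lowest T x" "\<forall>y. lowest T y \<longrightarrow> \<not> snd x < snd y"
    then show "x = p"
      using max[of x] p lowest_unique[OF T] by (metis antisym_conv2)
  qed
  finally show ?thesis .
qed

text \<open>Take a point in the lowest row that contains one: a cell below it would belong to a row
  with a point still further down.\<close>

lemma ex_lowest:
  assumes T: "tree_like T"
  shows "\<exists>p. lowest T p"
proof -
  define R where "R = Max (fst ` points T)"
  have fin: "finite (fst ` points T)"
    using tree_like_finite_points[OF T] by simp
  moreover have "fst ` points T \<noteq> {}"
    using T by (auto simp: tree_like_def)
  ultimately have "R \<in> fst ` points T"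
    unfolding R_def by (rule Max_in)
  then obtain j where j: "(R, j) \<in> points T"
    by auto
  have le: "fst p \<le> R" if "p \<in> points T" for p
    unfolding R_def using fin that by simp
  have "(Suc R, j) \<notin> cells T"
  proof
    assume "(Suc R, j) \<in> cells T"
    then obtain j' where "(Suc R, j') \<in> points T"
      by (rule tree_like_row[OF T])
    then show False
      using le by fastforce
  qed
  with j have "lowest T (R, j)"
    by (simp add: lowest_def)
  then show ?thesis ..
qed

lemma special_lowest_max:
  assumes T: "tree_like T"
  shows "lowest T (special T) \<and> (\<forall>q. lowest T q \<longrightarrow> snd q \<le> snd (special T))"
proof -
  have fin: "finite {p. lowest T p}"
    by (rule finite_subset[OF _ tree_like_finite_points[OF T]]) (auto simp: lowest_def)
  have "Max (snd ` {p. lowest T p}) \<in> snd ` {p. lowest T p}"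
    using fin ex_lowest[OF T] by (intro Max_in) auto
  then obtain p where p: "lowest T p" "snd p = Max (snd ` {p. lowest T p})"
    by auto
  have max: "snd q \<le> snd p" if "lowest T q" for q
    unfolding p(2) using fin that by (intro Max_ge) auto
  then have "special T = p"
    by (rule special_eqI[OF T p(1)])
  then show ?thesis
    using p(1) max by simp
qed

lemmas special_lowest = special_lowest_max[THEN conjunct1]
lemmas special_max = special_lowest_max[THEN conjunct2, rule_format]

text \<open>The part of an insertion that follows the insertion of a line with point \<open>p\<close>. The special
  point that delimits the ribbon can be read off after the insertion of the line.\<close>

definition close_at :: "tableau \<Rightarrow> cell \<Rightarrow> tableau" where
  "close_at T p =
     (if special T = p then T
      else T\<lparr>cells := cells T \<union>
        strip (cells T) (fst p, Suc (snd p)) (Suc (fst (special T)), snd (special T))\<rparr>)"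

text \<open>The case of a nonempty ribbon. \<open>T\<close> is the tableau after insertion of the
  line, \<open>(r, c)\<close> the new point and \<open>(k, l)\<close> the special point, which turns
  out to be strictly above and strictly to the right of it.\<close>

locale corner_tableau =
  fixes T :: tableau and r c k l :: nat
  assumes T: "tree_like T" and corner: "corner_point T (r, c)" and special: "special T = (k, l)"
    and special_neq: "(k, l) \<noteq> (r, c)"
begin

abbreviation "F \<equiv> cells T"
abbreviation "a \<equiv> (r, Suc c)"
abbreviation "b \<equiv> (Suc k, l)"
abbreviation "B \<equiv> strip F a b"

lemma F: "ferrers F"
  using T by (rule tree_like_ferrers)

lemmas down = ferrers_down[OF F]

lemma rc_point: "(r, c) \<in> points T" and rc: "(r, c) \<in> F" and below_rc: "(Suc r, c) \<notin> F"
  and right_rc: "a \<notin> F"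
  using corner tree_like_points[OF T] by (auto simp: corner_point_def lowest_def)

lemma kl_point: "(k, l) \<in> points T" and kl: "(k, l) \<in> F" and below_kl: "b \<notin> F"
  using special_lowest[OF T] special tree_like_points[OF T] by (auto simp: lowest_def)

lemma c_less_l: "c < l"
proof -
  have "c \<le> l"
    using special_max[OF T, of "(r, c)"] corner special by (simp add: corner_point_def)
  moreover have "c \<noteq> l"
    using lowest_unique[OF T, of "(r, c)" "(k, l)"] special_lowest[OF T] corner special special_neq
    by (auto simp: corner_point_def)
  ultimately show ?thesis
    by simp
qed

lemma k_less_r: "k < r"
proof (rule ccontr)
  assume "\<not> k < r"
  then have "a \<in> F"
    using down[OF kl, of r "Suc c"] c_less_l by simp
  with right_rc show False ..
qed

lemma a_outer: "a \<in> outer_strip F"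
  using right_rc rc down[of r c "r - 1" c] by (simp add: outer_strip_def)

lemma b_outer: "b \<in> outer_strip F"
  using below_kl kl down[of k l k "l - 1"] by (simp add: outer_strip_def)

lemma content_le: "content a \<le> content b"
  using c_less_l k_less_r by simp

lemma B_disj: "x \<in> B \<Longrightarrow> x \<notin> F"
  by (auto simp: strip_def outer_strip_def)

lemma B_rect: "x \<in> B \<Longrightarrow> k < fst x \<and> fst x \<le> r \<and> c < snd x \<and> snd x \<le> l"
  using outer_strip_mono[OF F a_outer, of x] outer_strip_mono[OF F _ b_outer, of x]
  by (auto simp: strip_def)

lemma a_B: "a \<in> B"
  using a_outer content_le by (auto simp: strip_def)

lemma close_at_eq: "close_at T (r, c) = T\<lparr>cells := F \<union> B\<rparr>"
  using special_neq by (auto simp: close_at_def special)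

lemma B_points: "x \<in> B \<Longrightarrow> x \<notin> points T"
  using B_disj tree_like_points[OF T] by blast

lemma B_row: "(i, j) \<in> B \<Longrightarrow> (i, c) \<in> F"
  using B_rect[of "(i, j)"] down[OF rc] by simp

lemma B_col: "(i, j) \<in> B \<Longrightarrow> (k, j) \<in> F"
  using B_rect[of "(i, j)"] down[OF kl] by simp

text \<open>The ribbon only adds empty cells, and it opens no new row or column because
  \<open>B_row\<close> and \<open>B_col\<close> find old cells in each of its lines.\<close>

lemma tree_like_close: "tree_like (close_at T (r, c))"
proof -
  have "fst ` (F \<union> B) = fst ` F" "snd ` (F \<union> B) = snd ` F"
    using B_row B_col by force+
  then show ?thesis
    using T ferrers_Un_strip[OF F a_outer b_outer rc kl]
    unfolding close_at_eq tree_like_def point_above_def point_left_def by auto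
qed

text \<open>The ribbon passes directly below every lowest point in the columns after
  \<open>c\<close> up to \<open>l\<close>, so none of these stays lowest, and no lowest point was
  further right.\<close>

lemma special_close: "special (close_at T (r, c)) = (r, c)"
proof (rule special_eqI[OF tree_like_close])
  show "lowest (close_at T (r, c)) (r, c)"
    using rc_point below_rc B_rect[of "(Suc r, c)"] by (auto simp: close_at_eq lowest_def)
next
  fix q assume "lowest (close_at T (r, c)) q"
  then have q: "lowest T q" "(Suc (fst q), snd q) \<notin> B"
    by (auto simp: close_at_eq lowest_def)
  show "snd q \<le> snd (r, c)"
  proof (rule ccontr)
    obtain i j where ij: "q = (i, j)"
      by fastforce
    assume "\<not> ?thesis"
    then have j: "c < j" "j \<le> l"
      using ij special_max[OF T q(1)] special by auto
    have "(i, j) \<in> F" "(Suc i, j) \<notin> F"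
      using q ij tree_like_points[OF T] by (auto simp: lowest_def)
    then have "(Suc i, j) \<in> outer_strip F"
      using down[of i j i "j - 1"] by (simp add: outer_strip_def)
    moreover have "Suc i \<le> r"
      using down[OF \<open>(i, j) \<in> F\<close>, of r "Suc c"] right_rc j by (cases "r \<le> i") auto
    moreover have "k \<le> i"
      using down[OF kl, of "Suc i" j] \<open>(Suc i, j) \<notin> F\<close> j by (cases "Suc i \<le> k") auto
    ultimately have "(Suc i, j) \<in> B"
      using j by (simp add: strip_def)
    with q(2) ij show False
      by simp
  qed
qed

text \<open>The row and the column of a ribbon cell already contain points of \<open>T\<close>.
  These lie in \<open>F\<close>, hence to the left of and above the cell, which is outside
  \<open>F\<close>.\<close>

lemma crossings_close: "crossings (close_at T (r, c)) = crossings T \<union> B"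
proof -
  have "point_above T x \<and> point_left T x" if "x \<in> B" for x
  proof -
    obtain i j where ij: "x = (i, j)"
      by fastforce
    note x = that[unfolded ij]
    obtain j' where j': "(i, j') \<in> points T"
      using tree_like_row[OF T B_row[OF x]] .
    then have "j' < j"
      using down[OF tree_like_points[OF T j'], of i j] B_disj[OF x] by (cases "j \<le> j'") auto
    obtain i' where i': "(i', j) \<in> points T"
      using tree_like_col[OF T B_col[OF x]] .
    then have "i' < i"
      using down[OF tree_like_points[OF T i'], of i j] B_disj[OF x] by (cases "i \<le> i'") auto
    with i' j' \<open>j' < j\<close> ij show ?thesis
      by (auto simp: point_above_def point_left_def)
  qed
  moreover have "crossings (close_at T (r, c)) =
      {x \<in> F \<union> B - points T. point_above T x \<and> point_left T x}"
    by (simp add: close_at_eq crossings_def point_above_def point_left_def)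
  ultimately show ?thesis
    using B_points by (auto simp: crossings_def)
qed

lemma cr_close: "int (cr (close_at T (r, c))) = int (cr T) + content (k, l) - content (r, c) - 1"
proof -
  have "finite (crossings T)"
    using ferrers_finite[OF F] by (simp add: crossings_def)
  moreover have "crossings T \<inter> B = {}"
    using B_disj by (auto simp: crossings_def)
  ultimately have "cr (close_at T (r, c)) = cr T + card B"
    unfolding cr_def crossings_close using finite_strip[OF F a_outer]
    by (simp add: card_Un_disjoint)
  then show ?thesis
    using card_strip[OF F a_outer, of b] content_le by simp
qed

text \<open>With \<open>cols_close\<close> this shows that the ribbon avoids the first row and
  column, so it changes neither the number of rows nor that of columns.\<close>

lemma rows_close: "(i, 0) \<in> cells (close_at T (r, c)) \<longleftrightarrow> (i, 0) \<in> F"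
  using B_rect[of "(i, 0)"] by (auto simp: close_at_eq)

lemma cols_close: "(0, j) \<in> cells (close_at T (r, c)) \<longleftrightarrow> (0, j) \<in> F"
  using B_rect[of "(0, j)"] by (auto simp: close_at_eq)

end

lemma close_at_trivial: "special T = p \<Longrightarrow> close_at T p = T"
  by (simp add: close_at_def)

lemma points_close_at [simp]: "points (close_at T p) = points T"
  by (simp add: close_at_def)

lemma corner_tableauI:
  assumes "tree_like T" "corner_point T p" "special T \<noteq> p"
  shows "corner_tableau T (fst p) (snd p) (fst (special T)) (snd (special T))"
  using assms by unfold_locales (auto simp: prod_eq_iff)

lemma close_at_props:
  assumes "tree_like T" "corner_point T p"
  shows tree_like_close_at: "tree_like (close_at T p)"
    and special_close_at: "special (close_at T p) = p"
    and rows_close_at: "(i, 0) \<in> cells (close_at T p) \<longleftrightarrow> (i, 0) \<in> cells T"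
    and cols_close_at: "(0, j) \<in> cells (close_at T p) \<longleftrightarrow> (0, j) \<in> cells T"
proof -
  show "tree_like (close_at T p)" "special (close_at T p) = p"
    "(i, 0) \<in> cells (close_at T p) \<longleftrightarrow> (i, 0) \<in> cells T"
    "(0, j) \<in> cells (close_at T p) \<longleftrightarrow> (0, j) \<in> cells T"
    using corner_tableau.tree_like_close[OF corner_tableauI[OF assms]]
      corner_tableau.special_close[OF corner_tableauI[OF assms]]
      corner_tableau.rows_close[OF corner_tableauI[OF assms]]
      corner_tableau.cols_close[OF corner_tableauI[OF assms]]
      close_at_trivial[of T p] assms by (cases "special T = p"; simp)+
qed

lemma cr_close_at:
  assumes "tree_like T" "corner_point T p"
  shows "int (cr (close_at T p)) =
    int (cr T) + (if special T = p then 0 else content (special T) - content p - 1)"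
  using corner_tableau.cr_close[OF corner_tableauI[OF assms]] close_at_trivial[of T p] by auto

text \<open>Both tableaux have the same points. If the ribbon of \<open>T2\<close> reached further,
  it would pass strictly Southeast of the point \<open>(k1, l1)\<close> on its diagonal. This puts
  \<open>(Suc k1, Suc l1)\<close> into the common diagram, but the ribbon of \<open>T1\<close> ends
  one diagonal earlier.\<close>

lemma close_at_inj_aux:
  assumes "corner_tableau T1 r c k1 l1" "corner_tableau T2 r c k2 l2"
    and eq: "close_at T1 (r, c) = close_at T2 (r, c)"
    and less: "content (k1, l1) < content (k2, l2)"
  shows False
proof -
  interpret t1: corner_tableau T1 r c k1 l1 by fact
  interpret t2: corner_tableau T2 r c k2 l2 by fact
  have cells: "t1.F \<union> t1.B = t2.F \<union> t2.B"
    using eq by (metis t1.close_at_eq t2.close_at_eq tableau.select_convs(1) tableau.surjective tableau.update_convs(1))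
  have "(k1, l1) \<in> points T2"
    using t1.kl_point arg_cong[OF eq, of points] by simp
  then have q: "(k1, l1) \<in> t2.F"
    by (rule tree_like_points[OF t2.T])
  have "content t1.a \<le> content (k1, l1)"
    using t1.content_le by simp
  then obtain x where x: "x \<in> outer_strip t2.F" "content x = content (k1, l1)"
    using outer_strip_at_content[OF t2.F t2.a_outer] by metis
  \<comment> \<open>The strict inequality matters: \<open>t2.b\<close> lies one diagonal before
    \<open>(k2, l2)\<close>, so its content is still at least that of
    \<open>(k1, l1)\<close>.\<close>
  then have "x \<in> t2.B"
    using less t1.content_le by (auto simp: strip_def)
  then have xF: "x \<in> t1.F \<union> t1.B" "x \<notin> t2.F"
    using cells t2.B_disj by auto
  obtain i j where ij: "x = (i, j)"
    by fastforce
  have "\<not> (i \<le> k1 \<and> j \<le> l1)"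
    using ij xF(2) ferrers_down[OF t2.F q, of i j] by auto
  then have "Suc k1 \<le> i \<and> Suc l1 \<le> j"
    using x(2) ij by auto
  moreover have "ferrers (t1.F \<union> t1.B)"
    using tree_like_ferrers[OF t1.tree_like_close] by (simp add: t1.close_at_eq)
  ultimately have "(Suc k1, Suc l1) \<in> t1.F \<union> t1.B"
    using ferrers_down xF(1) ij by blast
  then show False
    using t1.down[of "Suc k1" "Suc l1" "Suc k1" l1] t1.below_kl by (auto simp: strip_def)
qed

lemma close_at_inj:
  assumes "tree_like T1" "corner_point T1 p" "tree_like T2" "corner_point T2 p"
    and eq: "close_at T1 p = close_at T2 p"
  shows "T1 = T2"
proof -
  have pts: "points T1 = points T2"
    using arg_cong[OF eq, of points] by simp
  \<comment> \<open>Whether a ribbon was added is visible in the cell to the right of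
    \<open>p\<close>: it is outside the diagram before the closing and belongs to every nonempty
    ribbon.\<close>
  have triv: "special T = p" if "close_at T p = T'" "special T' = p" "tree_like T" "corner_point T p"
    "corner_point T' p" for T T'
  proof (rule ccontr)
    assume "special T \<noteq> p"
    then interpret corner_tableau T "fst p" "snd p" "fst (special T)" "snd (special T)"
      using corner_tableauI that by blast
    have "(fst p, Suc (snd p)) \<in> cells T'"
      using a_B that(1) close_at_eq by auto
    with that show False
      by (simp add: corner_point_def)
  qed
  show ?thesis
  proof (cases "special T1 = p \<or> special T2 = p")
    case True
    then show ?thesis
      using triv[of T1 T2] triv[of T2 T1] assms close_at_trivial by metis
  next
    case False
    interpret t1: corner_tableau T1 "fst p" "snd p" "fst (special T1)" "snd (special T1)"
      using corner_tableauI assms False by blast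
    interpret t2: corner_tableau T2 "fst p" "snd p" "fst (special T2)" "snd (special T2)"
      using corner_tableauI assms False by blast
    have c: "content (special T1) = content (special T2)"
      using close_at_inj_aux[OF t1.corner_tableau_axioms t2.corner_tableau_axioms]
        close_at_inj_aux[OF t2.corner_tableau_axioms t1.corner_tableau_axioms] eq
      by force
    then have c': "content t1.b = content t2.b"
      by (simp add: content_def)
    have cells: "t1.F \<union> t1.B = t2.F \<union> t2.B"
      using eq t1.close_at_eq t2.close_at_eq
      by (metis prod.collapse tableau.select_convs(1) tableau.surjective tableau.update_convs(1))
    \<comment> \<open>The two ribbons now cover the same diagonals. A cell \<open>x\<close> of
      \<open>T\<close> outside \<open>T'\<close> would be in the ribbon of \<open>T'\<close>, and
      the ribbon cell \<open>y\<close> of \<open>T\<close> on its diagonal, being beyond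
      \<open>x\<close>, would also have to be in the ribbon of \<open>T'\<close>.\<close>
    have sub: "cells T \<subseteq> cells T'"
      if "corner_tableau T (fst p) (snd p) k l" "corner_tableau T' (fst p) (snd p) k' l'"
        "cells T \<union> strip (cells T) t1.a (Suc k, l) = cells T' \<union> strip (cells T') t1.a (Suc k', l')"
        "content (Suc k, l) = content (Suc k', l')"
      for T T' k l k' l'
    proof
      interpret u1: corner_tableau T "fst p" "snd p" k l by fact
      interpret u2: corner_tableau T' "fst p" "snd p" k' l' by fact
      fix x assume x: "x \<in> cells T"
      show "x \<in> cells T'"
      proof (rule ccontr)
        assume nx: "x \<notin> cells T'"
        then have xB: "x \<in> u2.B"
          using x that(3) by blast
        then have "content x \<in> content ` u1.B"
          using strip_content_bij[OF u1.F u1.a_outer, of "(Suc k, l)"] that(4)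
          by (auto simp: bij_betw_def strip_def)
        then obtain y where y: "y \<in> u1.B" "content y = content x"
          by force
        obtain i j i' j' where xy: "x = (i, j)" "y = (i', j')"
          by fastforce
        have y': "y \<notin> cells T" "y \<in> cells T' \<union> u2.B"
          using y u1.B_disj that(3) by auto
        have "\<not> (i' \<le> i \<and> j' \<le> j)"
          using xy y'(1) x u1.down[of i j i' j'] by auto
        then have "i < i' \<and> j < j'"
          using y(2) xy by auto
        then have "y \<in> u2.B"
          using y'(2) u2.down[of i' j' i j] nx xy by auto
        then show False
          using outer_strip_unique[OF u2.F, of x y] xB y(2) x y'(1) by (auto simp: strip_def)
      qed
    qed
    have "cells T1 = cells T2"
      using sub[OF t1.corner_tableau_axioms t2.corner_tableau_axioms cells c']
        sub[OF t2.corner_tableau_axioms t1.corner_tableau_axioms cells[symmetric] c'[symmetric]]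
      by blast
    with pts show ?thesis
      by simp
  qed
qed

text \<open>If there is a cell to the right of the special point, the ribbon to remove consists of
  the rim cells from that cell up to the one just below the first rim point found Northeastwards.
  That point becomes the special point.\<close>

lemma close_at_surj:
  assumes T': "tree_like T'"
  shows "\<exists>T. tree_like T \<and> corner_point T (special T') \<and> close_at T (special T') = T'"
proof -
  obtain r c where sp: "special T' = (r, c)"
    by fastforce
  note F' = tree_like_ferrers[OF T']
  note down = ferrers_down[OF F']
  have low: "lowest T' (r, c)" and max: "\<And>q. lowest T' q \<Longrightarrow> snd q \<le> c"
    using special_lowest[OF T'] special_max[OF T'] sp by auto
  then have rc: "(r, c) \<in> points T'" "(r, c) \<in> cells T'" "(Suc r, c) \<notin> cells T'"
    using tree_like_points[OF T'] by (auto simp: lowest_def)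
  show ?thesis
  proof (cases "(r, Suc c) \<in> cells T'")
    case False
    then show ?thesis
      using T' sp low close_at_trivial[of T'] by (intro exI[of _ T']) (simp add: corner_point_def)
  next
    case True
    define I where "I = {(i, j). (i, j) \<in> cells T' \<and> (Suc i, Suc j) \<notin> cells T'}"
    have I_unique: "x = y" if "x \<in> I" "y \<in> I" "content x = content y" for x y
    proof -
      have *: "\<not> fst x < fst y" if "x \<in> I" "y \<in> I" "content x = content y" for x y
        using that down[of "fst y" "snd y" "Suc (fst x)" "Suc (snd x)"]
        by (auto simp: I_def content_def)
      show ?thesis
        using *[of x y] *[of y x] that by (simp add: prod_eq_iff content_def)
    qed
    define d where "d = content (r, Suc c)"
    \<comment> \<open>Candidates for the old special point: the points on the rim \<open>I\<close>
      from the first ribbon diagonal on. The one of least content is taken, so that no point gets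
      removed.\<close>
    define Q where "Q = {q \<in> points T'. q \<in> I \<and> d \<le> content q}"
    \<comment> \<open>\<open>Q\<close> is nonempty because of the last column: its point has no cell
      to its Southeast, hence is on the rim, and it is far enough to the Northeast.\<close>
    obtain m where m: "(0, m) \<in> cells T'" "(0, Suc m) \<notin> cells T'" "Suc c \<le> m"
    proof
      define m where "m = row_len (cells T') 0 - 1"
      have "(0, Suc c) \<in> cells T'"
        using down[OF True] by simp
      then show "(0, m) \<in> cells T'" "(0, Suc m) \<notin> cells T'" "Suc c \<le> m"
        unfolding mem_row_len[OF F'] m_def by auto
    qed
    obtain i where i: "(i, m) \<in> points T'"
      using tree_like_col[OF T' m(1)] .
    have "i \<le> r"
      using down[OF tree_like_points[OF T' i], of "Suc r" c] m(3) rc(3) by (cases "Suc r \<le> i") auto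
    moreover have "(i, m) \<in> I"
      using tree_like_points[OF T' i] m(2) down[of "Suc i" "Suc m" 0 "Suc m"] by (auto simp: I_def)
    ultimately have "(i, m) \<in> Q"
      using i m(3) by (simp add: Q_def d_def)
    moreover have "finite Q"
      using tree_like_finite_points[OF T'] by (simp add: Q_def)
    ultimately obtain q where q: "q \<in> Q" "\<And>q'. q' \<in> Q \<Longrightarrow> content q \<le> content q'"
      using ex_min_if_finite[of "content ` Q"]
      by (metis (no_types, lifting) empty_iff finite_imageI image_iff image_is_empty linorder_not_less)
    obtain k l where kl: "q = (k, l)"
      by fastforce
    have qp: "(k, l) \<in> points T'" "(k, l) \<in> I" "(k, l) \<in> cells T'" "(Suc k, Suc l) \<notin> cells T'"
      "d \<le> content (k, l)"
      using q(1) kl by (auto simp: Q_def I_def)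
    have c_l: "c < l"
    proof (rule ccontr)
      assume "\<not> c < l"
      then have "Suc k \<le> r" "Suc l \<le> Suc c"
        using qp(5) by (auto simp: d_def)
      then show False
        using down[OF True] qp(4) by blast
    qed
    have bF': "(Suc k, l) \<in> cells T'"
      using max[of "(k, l)"] qp(1) c_l by (auto simp: lowest_def)
    have bI: "(Suc k, l) \<in> I"
      using bF' qp(4) down[of "Suc (Suc k)" "Suc l" "Suc k" "Suc l"] by (auto simp: I_def)
    have aI: "(r, Suc c) \<in> I"
      using True rc(3) down[of "Suc r" "Suc (Suc c)" "Suc r" c] by (auto simp: I_def)
    have aP: "(r, Suc c) \<notin> points T'"
      using max[of "(r, Suc c)"] rc(3) down[of "Suc r" "Suc c" "Suc r" c] by (auto simp: lowest_def)
    \<comment> \<open>The ribbon is nonempty: \<open>q\<close> is not its first cell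
      \<open>(r, Suc c)\<close>, since a point there would be lowest and to the right of the special
      point.\<close>
    have db: "d \<le> content (Suc k, l)"
      using qp aP I_unique[OF qp(2) aI] by (fastforce simp: d_def)
    define B where "B = {x \<in> I. d \<le> content x \<and> content x \<le> content (Suc k, l)}"
    have B_points: "x \<notin> points T'" if "x \<in> B" for x
      using that q(2)[of x] kl by (auto simp: B_def Q_def)
    define F where "F = cells T' - B"
    have F: "ferrers F"
    proof (rule ferrersI_step)
      show "finite F"
        using ferrers_finite[OF F'] by (simp add: F_def)
    next
      fix i j
      assume "(Suc i, j) \<in> F"
      then have x: "(Suc i, j) \<in> cells T'" "(Suc i, j) \<notin> B"
        by (auto simp: F_def)
      \<comment> \<open>If only the upper of two cells were removed, the lower one would be a rim
        cell just before the first diagonal of \<open>B\<close>, so the upper one would be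
        \<open>(r, Suc c)\<close>, which has no cell below it.\<close>
      have "(i, j) \<notin> B"
      proof
        assume y: "(i, j) \<in> B"
        then have "(i, j) \<in> I"
          by (simp add: B_def)
        then have "(Suc i, j) \<in> I"
          using x(1) down[of "Suc (Suc i)" "Suc j" "Suc i" "Suc j"] by (auto simp: I_def)
        then have "content (i, j) = d"
          using x(2) y by (auto simp: B_def)
        then have "(i, j) = (r, Suc c)"
          using I_unique[OF \<open>(i, j) \<in> I\<close> aI] by (simp add: d_def)
        then show False
          using x(1) rc(3) down[of "Suc r" "Suc c" "Suc r" c] by simp
      qed
      then show "(i, j) \<in> F"
        using down[OF x(1), of i j] by (simp add: F_def)
    next
      fix i j
      assume "(i, Suc j) \<in> F"
      then have x: "(i, Suc j) \<in> cells T'" "(i, Suc j) \<notin> B"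
        by (auto simp: F_def)
      have "(i, j) \<notin> B"
      proof
        assume y: "(i, j) \<in> B"
        then have "(i, j) \<in> I"
          by (simp add: B_def)
        then have "(i, Suc j) \<in> I"
          using x(1) down[of "Suc i" "Suc (Suc j)" "Suc i" "Suc j"] by (auto simp: I_def)
        then have "content (i, j) = content (Suc k, l)"
          using x(2) y by (auto simp: B_def)
        then have "(i, j) = (Suc k, l)"
          using I_unique[OF \<open>(i, j) \<in> I\<close> bI] by simp
        then show False
          using x(1) qp(4) by simp
      qed
      then show "(i, j) \<in> F"
        using down[OF x(1), of i j] by (simp add: F_def)
    qed
    define T where "T = \<lparr>cells = F, points = points T'\<rparr>"
    have T: "tree_like T"
      using T' F B_points by (auto simp: T_def F_def tree_like_def point_above_def point_left_def)
    have aB: "(r, Suc c) \<in> B" and bB: "(Suc k, l) \<in> B"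
      using aI bI db by (auto simp: B_def d_def)
    have cornerT: "corner_point T (r, c)"
      using rc aB by (auto simp: corner_point_def lowest_def T_def F_def)
    have spT: "special T = (k, l)"
    proof (rule special_eqI[OF T])
      show "lowest T (k, l)"
        using qp(1) bB by (auto simp: lowest_def T_def F_def)
    next
      fix x assume x: "lowest T x"
      obtain i j where ij: "x = (i, j)"
        by fastforce
      show "snd x \<le> snd (k, l)"
      proof (cases "lowest T' x")
        case True
        then show ?thesis
          using max[of x] c_l by simp
      next
        case False
        then have "(Suc i, j) \<in> B"
          using x ij by (auto simp: lowest_def T_def F_def)
        then have *: "(Suc i, j) \<in> cells T'" "int j - int (Suc i) \<le> int l - int (Suc k)"
          by (auto simp: B_def I_def)
        show ?thesis
        proof (rule ccontr)
          assume "\<not> ?thesis"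
          then have "Suc k \<le> Suc i" "Suc l \<le> j"
            using *(2) ij by auto
          then show False
            using down[OF *(1)] qp(4) by blast
        qed
      qed
    qed
    \<comment> \<open>After the removal, the diagonals of \<open>B\<close> end one cell earlier: the
      predecessor of a rim cell is not on the rim and therefore stays in \<open>F\<close>. So the
      outer strip of \<open>F\<close> gives \<open>B\<close> back.\<close>
    have "F \<union> strip F (r, Suc c) (Suc k, l) = cells T'"
    proof -
      have "x \<in> strip F (r, Suc c) (Suc k, l)" if "x \<in> B" for x
      proof -
        obtain i j where ij: "x = (i, j)"
          by fastforce
        have "x \<notin> F"
          using that by (simp add: F_def)
        moreover have "i = 0 \<or> j = 0 \<or> (i - 1, j - 1) \<in> F"
          using that ij down[of i j "i - 1" "j - 1"] by (auto simp: F_def B_def I_def)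
        ultimately show ?thesis
          using that ij by (auto simp: strip_def outer_strip_def B_def d_def)
      qed
      moreover have "x \<in> cells T'" if x: "x \<in> strip F (r, Suc c) (Suc k, l)" for x
      proof (rule ccontr)
        assume nx: "x \<notin> cells T'"
        obtain i j where ij: "x = (i, j)"
          by fastforce
        have xs: "i = 0 \<or> j = 0 \<or> (i - 1, j - 1) \<in> F" "d \<le> int j - int i"
          "int j - int i \<le> int l - int (Suc k)"
          using x ij by (auto simp: strip_def outer_strip_def d_def)
        have "i \<noteq> 0"
          using xs(3) nx down[OF bF', of 0 j] ij by (cases "i = 0") auto
        moreover have "j \<noteq> 0"
          using xs(2) nx down[OF True, of i 0] ij by (cases "j = 0") (auto simp: d_def)
        ultimately have "(i - 1, j - 1) \<in> F" "(i - 1, j - 1) \<in> B"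
          using xs nx ij by (auto simp: F_def B_def I_def of_nat_diff)
        then show False
          by (simp add: F_def)
      qed
      ultimately show ?thesis
        by (auto simp: F_def)
    qed
    then have "close_at T (r, c) = T'"
      using spT c_l by (simp add: close_at_def T_def)
    then show ?thesis
      using T cornerT sp by auto
  qed
qed

section \<open>The border path and insertion of a column\<close>

lemma row_len_antimono:
  assumes "ferrers F" "i \<le> i'"
  shows "row_len F i' \<le> row_len F i"
  using ferrers_down[OF assms(1) _ assms(2) order_refl, of "row_len F i"]
  by (simp add: mem_row_len[OF assms(1)]) (meson not_le_imp_less order_less_irrefl)

lemma col_len_antimono:
  assumes "ferrers F" "j \<le> j'"
  shows "col_len F j' \<le> col_len F j"
  using ferrers_down[OF assms(1) _ order_refl assms(2), of "col_len F j"]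
  by (simp add: mem_col_len[OF assms(1)]) (meson not_le_imp_less order_less_irrefl)

lemma num_rows_iff: "ferrers F \<Longrightarrow> i < num_rows F \<longleftrightarrow> (i, 0) \<in> F"
  by (simp add: num_rows_col_len mem_col_len)

lemma col_len_le_num_rows: "ferrers F \<Longrightarrow> col_len F j \<le> num_rows F"
  by (simp add: num_rows_col_len col_len_antimono)

lemma row_len_num_rows: "ferrers F \<Longrightarrow> row_len F (num_rows F) = 0"
  using num_rows_iff[of F "num_rows F"] mem_row_len[of F "num_rows F" 0] by auto

text \<open>The number of edges passed before this one: the row ends below it plus the column
  bottoms to its left.\<close>

fun edge_index :: "cell set \<Rightarrow> edge \<Rightarrow> nat" where
  "edge_index F (Row_End r) = num_rows F - Suc r + row_len F r"
| "edge_index F (Col_Bottom c) = num_rows F - col_len F c + c"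

fun valid_edge :: "cell set \<Rightarrow> edge \<Rightarrow> bool" where
  "valid_edge F (Row_End r) = ((r, 0) \<in> F)"
| "valid_edge F (Col_Bottom c) = ((0, c) \<in> F)"

definition boundary_block :: "cell set \<Rightarrow> nat \<Rightarrow> edge list" where
  "boundary_block F i = map Col_Bottom [row_len F (Suc i) ..< row_len F i] @ [Row_End i]"

lemma boundary_blocks: "boundary F = concat (map (boundary_block F) (rev [0 ..< num_rows F]))"
  by (simp add: boundary_def boundary_block_def[abs_def])

text \<open>The row lengths telescope, and the row after the last one has length 0.\<close>

lemma length_blocks:
  assumes F: "ferrers F" and "m \<le> num_rows F"
  shows "length (concat (map (boundary_block F) (rev [m ..< num_rows F]))) =
    num_rows F - m + row_len F m"
  using assms(2)
proof (induction rule: inc_induct)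
  case base
  then show ?case
    using row_len_num_rows[OF F] by simp
next
  case (step m)
  have "length (boundary_block F m) = Suc (row_len F m - row_len F (Suc m))"
    by (simp add: boundary_block_def)
  moreover have "row_len F (Suc m) \<le> row_len F m"
    by (simp add: row_len_antimono[OF F])
  ultimately show ?case
    using step by (simp add: upt_conv_Cons)
qed

lemma length_boundary:
  assumes "ferrers F"
  shows "length (boundary F) = num_rows F + row_len F 0"
  using length_blocks[OF assms, of 0] by (simp add: boundary_blocks)

lemma boundary_split:
  assumes "i < num_rows F"
  shows "boundary F = concat (map (boundary_block F) (rev [Suc i ..< num_rows F])) @
    boundary_block F i @ concat (map (boundary_block F) (rev [0 ..< i]))"
proof -
  have "[0 ..< num_rows F] = [0 ..< i] @ i # [Suc i ..< num_rows F]"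
    using assms upt_add_eq_append[of 0 i "num_rows F - i"] by (simp add: upt_conv_Cons)
  then show ?thesis
    by (simp add: boundary_blocks)
qed

lemma nth_boundary:
  assumes F: "ferrers F" and "valid_edge F e"
  shows "edge_index F e < length (boundary F)" "boundary F ! edge_index F e = e"
proof -
  have "edge_index F e < length (boundary F) \<and> boundary F ! edge_index F e = e"
  proof (cases e)
    case (Row_End r)
    have r: "r < num_rows F"
      using assms Row_End num_rows_iff by simp
    have le: "row_len F (Suc r) \<le> row_len F r"
      by (simp add: row_len_antimono[OF F])
    have "edge_index F e = length (concat (map (boundary_block F) (rev [Suc r ..< num_rows F]))) +
        (row_len F r - row_len F (Suc r))"
      using length_blocks[OF F, of "Suc r"] r le Row_End by simp
    moreover have "edge_index F e < length (boundary F)"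
      using r row_len_antimono[OF F, of 0 r] Row_End length_boundary[OF F] by simp
    moreover have "boundary_block F r ! (row_len F r - row_len F (Suc r)) = Row_End r"
      "row_len F r - row_len F (Suc r) < length (boundary_block F r)"
      by (simp_all add: boundary_block_def nth_append)
    ultimately show ?thesis
      using Row_End by (subst (2) boundary_split[OF r]) (simp add: nth_append)
  next
    case (Col_Bottom c)
    have "(0, c) \<in> F"
      using assms Col_Bottom by simp
    then have "0 < col_len F c"
      using mem_col_len[OF F] by simp
    then obtain i where i: "col_len F c = Suc i"
      using gr0_conv_Suc by blast
    have r: "i < num_rows F"
      using col_len_le_num_rows[OF F, of c] i by simp
    have c: "c < row_len F i" "row_len F (Suc i) \<le> c"
      using mem_col_len[OF F, of i c] mem_col_len[OF F, of "Suc i" c] i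
      by (auto simp: mem_row_len[OF F])
    \<comment> \<open>The bottom of column \<open>c\<close> is in the block of row \<open>i\<close>,
      which starts with column \<open>row_len F (Suc i)\<close>.\<close>
    have "edge_index F e = length (concat (map (boundary_block F) (rev [Suc i ..< num_rows F]))) +
        (c - row_len F (Suc i))"
      using length_blocks[OF F, of "Suc i"] r c i Col_Bottom by simp
    moreover have "edge_index F e < length (boundary F)"
      using r i c row_len_antimono[OF F, of 0 i] Col_Bottom length_boundary[OF F] by simp
    moreover have "boundary_block F i ! (c - row_len F (Suc i)) = Col_Bottom c"
      "c - row_len F (Suc i) < length (boundary_block F i)"
      using c by (auto simp: boundary_block_def nth_append)
    ultimately show ?thesis
      using Col_Bottom by (subst (2) boundary_split[OF r]) (simp add: nth_append)
  qed
  then show "edge_index F e < length (boundary F)" "boundary F ! edge_index F e = e"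
    by auto
qed

lemma set_boundary:
  assumes F: "ferrers F"
  shows "set (boundary F) = {e. valid_edge F e}"
proof
  show "{e. valid_edge F e} \<subseteq> set (boundary F)"
    using nth_boundary[OF F] nth_mem by fastforce
  show "set (boundary F) \<subseteq> {e. valid_edge F e}"
  proof
    fix e assume "e \<in> set (boundary F)"
    then obtain i where i: "i < num_rows F" "e \<in> set (boundary_block F i)"
      by (auto simp: boundary_blocks)
    have "(0, c) \<in> F" if "c < row_len F i" for c
      using ferrers_down[OF F, of i c 0 c] that mem_row_len[OF F] by simp
    then show "e \<in> {e. valid_edge F e}"
      using i num_rows_iff[OF F] by (auto simp: boundary_block_def)
  qed
qed

text \<open>By counting: the list is exactly as long as the set of valid edges is large.\<close>

lemma distinct_boundary:
  assumes F: "ferrers F"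
  shows "distinct (boundary F)"
proof (rule card_distinct)
  have "{e. valid_edge F e} = Row_End ` {..<num_rows F} \<union> Col_Bottom ` {..<row_len F 0}"
  proof (intro set_eqI)
    fix e show "e \<in> {e. valid_edge F e} \<longleftrightarrow>
        e \<in> Row_End ` {..<num_rows F} \<union> Col_Bottom ` {..<row_len F 0}"
      using num_rows_iff[OF F] mem_row_len[OF F] by (cases e) auto
  qed
  moreover have "card (Row_End ` {..<num_rows F} \<union> Col_Bottom ` {..<row_len F 0}) =
      num_rows F + row_len F 0"
    by (subst card_Un_disjoint) (auto simp: card_image inj_on_def)
  ultimately show "card (set (boundary F)) = length (boundary F)"
    using set_boundary[OF F] length_boundary[OF F] by simp
qed

lemma boundary_nth_valid:
  assumes F: "ferrers F" and "j < length (boundary F)"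
  shows "valid_edge F (boundary F ! j)" "edge_index F (boundary F ! j) = j"
proof -
  show v: "valid_edge F (boundary F ! j)"
    using set_boundary[OF F] nth_mem[OF assms(2)] by blast
  show "edge_index F (boundary F ! j) = j"
    using nth_boundary[OF F v] distinct_boundary[OF F] assms(2) nth_eq_iff_index_eq by blast
qed

lemma northeast_of_iff:
  assumes F: "ferrers F" and "valid_edge F e" "valid_edge F e'"
  shows "northeast_of F e e' \<longleftrightarrow> edge_index F e' < edge_index F e"
proof
  assume "northeast_of F e e'"
  then obtain i j where "i < j" "j < length (boundary F)" "boundary F ! i = e'" "boundary F ! j = e"
    by (auto simp: northeast_of_def)
  then show "edge_index F e' < edge_index F e"
    using boundary_nth_valid(2)[OF F, of i] boundary_nth_valid(2)[OF F, of j] by auto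
next
  assume "edge_index F e' < edge_index F e"
  then show "northeast_of F e e'"
    unfolding northeast_of_def using nth_boundary[OF F] assms by blast
qed

lemma edge_index_inj:
  assumes F: "ferrers F" and "valid_edge F e" "valid_edge F e'" "edge_index F e = edge_index F e'"
  shows "e = e'"
  using nth_boundary(2)[OF F] assms by metis

section \<open>Insertion and deletion of a column\<close>

lemma bump_neq [simp]: "bump k x \<noteq> k" "k \<noteq> bump k x"
  by (auto simp: bump_def)

lemma bump_less_iff [simp]: "bump k x < bump k y \<longleftrightarrow> x < y"
  by (auto simp: bump_def)

lemma bump_eq_iff [simp]: "bump k x = bump k y \<longleftrightarrow> x = y"
  by (auto simp: bump_def)

lemma bump_cases:
  obtains "x = k" | y where "x = bump k y"
proof (cases x k rule: linorder_cases)
  case less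
  then show ?thesis
    using that(2)[of x] by (simp add: bump_def)
next
  case greater
  then show ?thesis
    using that(2)[of "x - 1"] by (auto simp: bump_def)
qed (use that in auto)

locale column_insertion =
  fixes T :: tableau and r :: nat
  assumes T: "tree_like T" and r: "(r, 0) \<in> cells T"
begin

abbreviation "F \<equiv> cells T"
abbreviation "c \<equiv> row_len F r"
abbreviation "T' \<equiv> insert_line T (Row_End r)"

lemma F: "ferrers F"
  using T by (rule tree_like_ferrers)

lemma mem_r: "(r, j) \<in> F \<longleftrightarrow> j < c"
  by (rule mem_row_len[OF F])

lemma c_pos: "0 < c"
  using mem_r r by blast

lemma cells_old [simp]: "(i, bump c j) \<in> cells T' \<longleftrightarrow> (i, j) \<in> F"
  by (force simp: insert_line_def)

lemma cells_new [simp]: "(i, c) \<in> cells T' \<longleftrightarrow> i \<le> r"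
  by (force simp: insert_line_def)

lemma points_old [simp]: "(i, bump c j) \<in> points T' \<longleftrightarrow> (i, j) \<in> points T"
  by (force simp: insert_line_def)

lemma points_new [simp]: "(i, c) \<in> points T' \<longleftrightarrow> i = r"
  by (force simp: insert_line_def)

lemma bump_0 [simp]: "bump c 0 = 0"
  using c_pos by (simp add: bump_def)

lemma point_above_old [simp]: "point_above T' (i, bump c j) \<longleftrightarrow> point_above T (i, j)"
  by (simp add: point_above_def)

text \<open>The new point ends row \<open>r\<close>, so it has no old cell to its right. For
  positions outside \<open>F\<close> this would be false.\<close>

lemma point_left_old [simp]:
  assumes "(i, j) \<in> F"
  shows "point_left T' (i, bump c j) \<longleftrightarrow> point_left T (i, j)"
proof
  assume "point_left T' (i, bump c j)"
  then obtain j' where j': "j' < bump c j" "(i, j') \<in> points T'"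
    by (auto simp: point_left_def)
  show "point_left T (i, j)"
  proof (cases j' c rule: bump_cases)
    case 1
    then have "i = r" "c < bump c j"
      using j' by auto
    then show ?thesis
      using assms mem_r by (auto simp: bump_def split: if_splits)
  next
    case (2 j'')
    then show ?thesis
      using j' by (auto simp: point_left_def)
  qed
next
  assume "point_left T (i, j)"
  then obtain j' where "j' < j" "(i, j') \<in> points T"
    by (auto simp: point_left_def)
  then show "point_left T' (i, bump c j)"
    by (auto simp: point_left_def intro!: exI[of _ "bump c j'"])
qed

lemma not_point_above_new [simp]: "i \<le> r \<Longrightarrow> \<not> point_above T' (i, c)"
  by (auto simp: point_above_def)

lemma point_left_new: "point_left T' (r, c)"
proof -
  obtain j where "(r, j) \<in> points T"
    using tree_like_row[OF T r] .
  moreover from this have "j < c"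
    using tree_like_points[OF T] mem_r by blast
  ultimately have "(r, bump c j) \<in> points T'" "bump c j < c"
    by (simp_all only: points_old) (simp add: bump_def)
  then show ?thesis
    by (auto simp: point_left_def)
qed

lemma finite_cells: "finite (cells T')"
  using ferrers_finite[OF F] by (simp add: insert_line_def)

lemma ferrers_insert: "ferrers (cells T')"
proof (rule ferrersI_step[OF finite_cells])
  fix i j assume ij: "(Suc i, j) \<in> cells T'"
  show "(i, j) \<in> cells T'"
  proof (cases j c rule: bump_cases)
    case 1
    then show ?thesis
      using ij by simp
  next
    case (2 j')
    then show ?thesis
      using ij ferrers_down[OF F, of "Suc i" j' i j'] by simp
  qed
next
  fix i j assume ij: "(i, Suc j) \<in> cells T'"
  have down: "(i, y) \<in> F" if "(i, x) \<in> F" "y \<le> x" for x y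
    using ferrers_down[OF F that(1), of i y] that(2) by simp
  show "(i, j) \<in> cells T'"
  proof (cases j c rule: bump_cases)
    case 1
    \<comment> \<open>The right neighbour of a cell in the new column comes from the old column
      \<open>c\<close>; its row is longer than row \<open>r\<close> and hence above it.\<close>
    then have "Suc j = bump c j"
      by (simp add: bump_def)
    then have "(i, c) \<in> F"
      using ij 1 cells_old[of i c] by simp
    then have "i < r"
      using ferrers_down[OF F, of i c r c] mem_r[of c] by (cases "i < r") auto
    then show ?thesis
      using 1 by simp
  next
    case (2 j')
    show ?thesis
    proof (cases "Suc j" c rule: bump_cases)
      case 1
      then have "i \<le> r"
        using ij by simp
      moreover have "(r, j') \<in> F"
        using 1 2 mem_r by (auto simp: bump_def split: if_splits)
      ultimately show ?thesis
        using 2 ferrers_down[OF F, of r j' i j'] by simp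
    next
      fix y assume y: "Suc j = bump c y"
      then have "j' \<le> y"
        using 2 by (auto simp: bump_def split: if_splits)
      then show ?thesis
        using down[of y j'] ij 2 y by simp
    qed
  qed
qed

lemma tree_like_insert: "tree_like T'"
  unfolding tree_like_def
proof (intro conjI ballI)
  show "ferrers (cells T')"
    by (rule ferrers_insert)
  show "points T' \<subseteq> cells T'"
  proof
    fix p assume p: "p \<in> points T'"
    obtain i j where ij: "p = (i, j)"
      by fastforce
    show "p \<in> cells T'"
      using p ij tree_like_points[OF T] by (cases j c rule: bump_cases) auto
  qed
  show "(0, 0) \<in> points T'"
    using points_old[of 0 0] T by (simp add: tree_like_def)
next
  fix p assume p: "p \<in> points T' - {(0, 0)}"
  obtain i j where ij: "p = (i, j)"
    by fastforce
  show "point_above T' p \<noteq> point_left T' p"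
  proof (cases j c rule: bump_cases)
    case 1
    then show ?thesis
      using p ij point_left_new by auto
  next
    case (2 j')
    then have "(i, j') \<in> points T - {(0, 0)}"
      using p ij by auto
    moreover from this have "(i, j') \<in> F"
      using tree_like_points[OF T] by blast
    ultimately show ?thesis
      using T ij 2 by (auto simp: tree_like_def)
  qed
next
  fix i assume "i \<in> fst ` cells T'"
  then obtain j where ij: "(i, j) \<in> cells T'"
    by force
  have "(i, 0) \<in> F"
    using ferrers_down[OF ferrers_insert ij, of i "bump c 0"] by (simp del: bump_0) (simp add: bump_0)
  then obtain j' where "(i, j') \<in> points T"
    by (rule tree_like_row[OF T])
  then show "\<exists>j. (i, j) \<in> points T'"
    using points_old by blast
next
  fix j assume "j \<in> snd ` cells T'"
  then obtain i where ij: "(i, j) \<in> cells T'"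
    by force
  show "\<exists>i. (i, j) \<in> points T'"
  proof (cases j c rule: bump_cases)
    case (2 j')
    then obtain i' where "(i', j') \<in> points T"
      using ij tree_like_col[OF T, of i j'] by auto
    then show ?thesis
      using 2 by auto
  qed auto
qed

lemma corner_insert: "corner_point T' (r, c)"
proof -
  \<comment> \<open>\<open>bump c c\<close> is \<open>Suc c\<close>: this is the cell to the right
    of the new point.\<close>
  have "(r, bump c c) \<notin> cells T'"
    using mem_r by simp
  then show ?thesis
    by (simp add: corner_point_def lowest_def bump_def del: cells_old)
qed

lemma card_points_insert: "card (points T') = Suc (card (points T))"
proof -
  have "inj (shift_cell F (Row_End r))"
    by (auto simp: inj_def)
  moreover have "(r, c) \<notin> shift_cell F (Row_End r) ` points T"
    by (auto simp: bump_def split: if_splits)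
  ultimately show ?thesis
    using tree_like_finite_points[OF T]
    by (simp add: insert_line_def card_image[OF inj_on_subset[OF _ subset_UNIV]])
qed

text \<open>The empty cells of the new column are above its only point, so none of them has a point
  above it.\<close>

lemma cr_insert: "cr T' = cr T"
proof -
  have "crossings T' = (\<lambda>(i, j). (i, bump c j)) ` crossings T"
  proof (intro set_eqI)
    fix p :: cell
    obtain i j where ij: "p = (i, j)"
      by fastforce
    show "p \<in> crossings T' \<longleftrightarrow> p \<in> (\<lambda>(i, j). (i, bump c j)) ` crossings T"
    proof (cases j c rule: bump_cases)
      case 1
      then show ?thesis
        using ij by (auto simp: crossings_def)
    next
      case (2 j')
      then have "p \<in> crossings T' \<longleftrightarrow> (i, j') \<in> crossings T"
        using ij by (auto simp: crossings_def)
      also have "\<dots> \<longleftrightarrow> p \<in> (\<lambda>(i, j). (i, bump c j)) ` crossings T"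
        using ij 2 by force
      finally show ?thesis .
    qed
  qed
  moreover have "inj (\<lambda>(i, j). (i :: nat, bump c j))"
    by (auto simp: inj_def)
  ultimately show ?thesis
    by (simp add: cr_def card_image[OF inj_on_subset[OF _ subset_UNIV]])
qed

lemma rows_insert: "(i, 0) \<in> cells T' \<longleftrightarrow> (i, 0) \<in> F"
  using cells_old[of i 0] by simp

lemma row_len_insert: "row_len (cells T') 0 = Suc (row_len F 0)"
proof (rule row_len_eqI)
  fix j
  have le: "c \<le> row_len F 0"
    by (rule row_len_antimono[OF F]) simp
  show "(0, j) \<in> cells T' \<longleftrightarrow> j < Suc (row_len F 0)"
  proof (cases j c rule: bump_cases)
    case (2 j')
    then have "(0, j) \<in> cells T' \<longleftrightarrow> j' < row_len F 0"
      by (simp add: mem_row_len[OF F])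
    also have "\<dots> \<longleftrightarrow> j < Suc (row_len F 0)"
      using 2 le by (auto simp: bump_def)
    finally show ?thesis .
  qed (use le in auto)
qed

end

text \<open>With no point above and no cell below, \<open>(r, c)\<close> is the only point of its
  column. It is also the end of its row, so deleting the column leaves row \<open>r\<close> with
  length \<open>c\<close> and \<open>Row_End r\<close> puts the column back at the same
  place.\<close>

lemma column_deletion:
  assumes T': "tree_like T'" and corner: "corner_point T' (r, c)" and pl: "point_left T' (r, c)"
    and pa: "\<not> point_above T' (r, c)"
  shows "\<exists>T. tree_like T \<and> (r, 0) \<in> cells T \<and> row_len (cells T) r = c \<and> insert_line T (Row_End r) = T'"
proof -
  note F' = tree_like_ferrers[OF T']
  note down = ferrers_down[OF F']
  have rc: "(r, c) \<in> points T'" "(r, c) \<in> cells T'" "(Suc r, c) \<notin> cells T'" "(r, Suc c) \<notin> cells T'"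
    using corner tree_like_points[OF T'] by (auto simp: corner_point_def lowest_def)
  obtain j0 where j0: "j0 < c" "(r, j0) \<in> points T'"
    using pl by (auto simp: point_left_def)
  have col: "(i, c) \<in> cells T' \<longleftrightarrow> i \<le> r" for i
    using down[OF rc(2), of i c] down[of i c "Suc r" c] rc(3) by (cases "i \<le> r") auto
  have colp: "(i, c) \<in> points T' \<longleftrightarrow> i = r" for i
    using rc(1) pa col[of i] tree_like_points[OF T', of "(i, c)"]
    by (auto simp: point_above_def order_le_less)
  have rowr: "(r, j) \<in> cells T' \<longleftrightarrow> j \<le> c" for j
    using down[OF rc(2), of r j] down[of r j r "Suc c"] rc(4) by (cases "j \<le> c") auto
  have b0 [simp]: "bump c 0 = 0"
    using j0 by (simp add: bump_def)
  define F where "F = {(i, j). (i, bump c j) \<in> cells T'}"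
  define P where "P = {(i, j). (i, bump c j) \<in> points T'}"
  define T where "T = \<lparr>cells = F, points = P\<rparr>"
  have T_mem [simp]: "(i, j) \<in> cells T \<longleftrightarrow> (i, bump c j) \<in> cells T'"
    "(i, j) \<in> points T \<longleftrightarrow> (i, bump c j) \<in> points T'" for i j
    by (auto simp: T_def F_def P_def)
  have img: "F = (\<lambda>(i, j). (i, bump c j)) -` cells T'"
    by (auto simp: F_def)
  have F: "ferrers F"
  proof (rule ferrersI)
    show "finite F"
      unfolding img by (rule finite_vimageI[OF ferrers_finite[OF F']]) (auto simp: inj_def)
    fix i j i' j' assume "(i, j) \<in> F" "i' \<le> i" "j' \<le> j"
    then show "(i', j') \<in> F"
      using down[of i "bump c j" i' "bump c j'"] by (auto simp: F_def bump_def split: if_splits)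
  qed
  have above: "point_above T (i, j) \<longleftrightarrow> point_above T' (i, bump c j)" for i j
    by (simp add: point_above_def)
  have left: "point_left T (i, j) \<longleftrightarrow> point_left T' (i, bump c j)" if "(i, j) \<in> F" for i j
  proof
    assume "point_left T' (i, bump c j)"
    then obtain j' where j': "j' < bump c j" "(i, j') \<in> points T'"
      by (auto simp: point_left_def)
    show "point_left T (i, j)"
    proof (cases j' c rule: bump_cases)
      case 1
      then show ?thesis
        using j' colp[of i] rowr[of "bump c j"] that by (auto simp: F_def)
    next
      case (2 j'')
      then show ?thesis
        using j' by (auto simp: point_left_def)
    qed
  next
    assume "point_left T (i, j)"
    then obtain j' where "j' < j" "(i, bump c j') \<in> points T'"
      by (auto simp: point_left_def)
    then show "point_left T' (i, bump c j)"
      by (auto simp: point_left_def intro!: exI[of _ "bump c j'"])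
  qed
  have "tree_like T"
    unfolding tree_like_def
  proof (intro conjI ballI)
    show "ferrers (cells T)"
      using F by (simp add: T_def)
    show "points T \<subseteq> cells T"
      using tree_like_points[OF T'] by auto
    show "(0, 0) \<in> points T"
      using T' by (simp add: tree_like_def)
  next
    fix p assume p: "p \<in> points T - {(0, 0)}"
    obtain i j where ij: "p = (i, j)"
      by fastforce
    have "(i, bump c j) \<in> points T' - {(0, 0)}"
      using p ij b0 bump_eq_iff[of c j 0] by (auto simp del: bump_eq_iff)
    moreover from this have "(i, j) \<in> F"
      using tree_like_points[OF T'] by (auto simp: F_def)
    ultimately show "point_above T p \<noteq> point_left T p"
      using T' above left ij by (auto simp: tree_like_def)
  next
    fix i assume "i \<in> fst ` cells T"
    then obtain j where "(i, bump c j) \<in> cells T'"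
      by force
    then obtain j' where j': "(i, j') \<in> points T'"
      by (rule tree_like_row[OF T'])
    show "\<exists>j. (i, j) \<in> points T"
    proof (cases j' c rule: bump_cases)
      \<comment> \<open>Only row \<open>r\<close> loses a point, and there \<open>j0\<close>
        remains.\<close>
      case 1
      then have "i = r"
        using j' colp by simp
      moreover have "bump c j0 = j0"
        using j0 by (simp add: bump_def)
      ultimately show ?thesis
        using j0 by (intro exI[of _ j0]) simp
    qed (use j' in auto)
  next
    fix j assume "j \<in> snd ` cells T"
    then obtain i where "(i, bump c j) \<in> cells T'"
      by force
    then obtain i' where "(i', bump c j) \<in> points T'"
      by (rule tree_like_col[OF T'])
    then show "\<exists>i. (i, j) \<in> points T"
      by auto
  qed
  moreover have r0: "(r, 0) \<in> cells T"
    using rowr[of 0] by simp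
  moreover have rl: "row_len (cells T) r = c"
    by (rule row_len_eqI) (auto simp: rowr bump_def)
  moreover have "insert_line T (Row_End r) = T'"
  proof -
    interpret column_insertion T r
      using \<open>tree_like T\<close> r0 by unfold_locales
    have "(i, j) \<in> cells (insert_line T (Row_End r)) \<longleftrightarrow> (i, j) \<in> cells T'"
      "(i, j) \<in> points (insert_line T (Row_End r)) \<longleftrightarrow> (i, j) \<in> points T'" for i j
      using cells_old points_old cells_new points_new col colp
      by (cases j c rule: bump_cases; simp add: rl)+
    then have "cells (insert_line T (Row_End r)) = cells T'"
      "points (insert_line T (Row_End r)) = points T'"
      by auto
    then show ?thesis
      by simp
  qed
  ultimately show ?thesis
    by blast
qed

lemma column_insertion_inj:
  assumes "column_insertion T1 r" "column_insertion T2 r"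
    and len: "row_len (cells T1) r = row_len (cells T2) r"
    and eq: "insert_line T1 (Row_End r) = insert_line T2 (Row_End r)"
  shows "T1 = T2"
proof -
  interpret t1: column_insertion T1 r by fact
  interpret t2: column_insertion T2 r by fact
  have "(i, j) \<in> cells T1 \<longleftrightarrow> (i, j) \<in> cells T2" "(i, j) \<in> points T1 \<longleftrightarrow> (i, j) \<in> points T2" for i j
    using t1.cells_old[of i j] t2.cells_old[of i j] t1.points_old[of i j] t2.points_old[of i j]
    unfolding eq len by simp_all
  then have "cells T1 = cells T2" "points T1 = points T2"
    by auto
  then show ?thesis
    by simp
qed

section \<open>Insertion of points\<close>

definition transpose_tableau :: "tableau \<Rightarrow> tableau" where
  "transpose_tableau T = \<lparr>cells = prod.swap ` cells T, points = prod.swap ` points T\<rparr>"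

lemma cells_transpose: "cells (transpose_tableau T) = prod.swap ` cells T"
  and points_transpose: "points (transpose_tableau T) = prod.swap ` points T"
  by (simp_all add: transpose_tableau_def)

lemma transpose_mem [simp]:
  "(i, j) \<in> cells (transpose_tableau T) \<longleftrightarrow> (j, i) \<in> cells T"
  "(i, j) \<in> points (transpose_tableau T) \<longleftrightarrow> (j, i) \<in> points T"
  by (simp_all add: transpose_tableau_def)

lemma transpose_transpose [simp]: "transpose_tableau (transpose_tableau T) = T"
  by (simp add: transpose_tableau_def image_image)

lemma transpose_eq_iff [simp]: "transpose_tableau T1 = transpose_tableau T2 \<longleftrightarrow> T1 = T2"
  by (rule inj_eq, rule inj_on_inverseI[where g = transpose_tableau]) simp

lemma transpose_point [simp]:
  "point_above (transpose_tableau T) (i, j) \<longleftrightarrow> point_left T (j, i)"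
  "point_left (transpose_tableau T) (i, j) \<longleftrightarrow> point_above T (j, i)"
  by (auto simp: point_above_def point_left_def)

lemma transpose_len [simp]:
  "row_len (cells (transpose_tableau T)) i = col_len (cells T) i"
  "col_len (cells (transpose_tableau T)) i = row_len (cells T) i"
  by (auto simp: row_len_def col_len_def)

lemma card_points_transpose [simp]: "card (points (transpose_tableau T)) = card (points T)"
  by (simp add: transpose_tableau_def card_image)

lemma cr_transpose [simp]: "cr (transpose_tableau T) = cr T"
proof -
  have "(i, j) \<in> crossings (transpose_tableau T) \<longleftrightarrow> (i, j) \<in> prod.swap ` crossings T" for i j
    by (auto simp: crossings_def)
  then have "crossings (transpose_tableau T) = prod.swap ` crossings T"
    by auto
  then show ?thesis
    by (simp add: cr_def card_image)
qed

lemma corner_point_transpose: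
  assumes "corner_point T (i, j)"
  shows "corner_point (transpose_tableau T) (j, i)"
  using assms by (simp add: corner_point_def lowest_def)

lemma ferrers_transpose:
  assumes "ferrers (cells T)"
  shows "ferrers (cells (transpose_tableau T))"
proof (rule ferrersI)
  show "finite (cells (transpose_tableau T))"
    using ferrers_finite[OF assms] by (simp add: transpose_tableau_def)
  fix i j i' j' assume "(i, j) \<in> cells (transpose_tableau T)" "i' \<le> i" "j' \<le> j"
  then show "(i', j') \<in> cells (transpose_tableau T)"
    using ferrers_down[OF assms, of j i j' i'] by simp
qed

lemma tree_like_transpose:
  assumes T: "tree_like T"
  shows "tree_like (transpose_tableau T)"
  unfolding tree_like_def
proof (intro conjI ballI)
  show "ferrers (cells (transpose_tableau T))"
    by (rule ferrers_transpose[OF tree_like_ferrers[OF T]])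
  show "points (transpose_tableau T) \<subseteq> cells (transpose_tableau T)"
    using tree_like_points[OF T] by auto
  show "(0, 0) \<in> points (transpose_tableau T)"
    using T by (simp add: tree_like_def)
next
  fix p assume p: "p \<in> points (transpose_tableau T) - {(0, 0)}"
  obtain i j where ij: "p = (i, j)"
    by fastforce
  then have "(j, i) \<in> points T - {(0, 0)}"
    using p by auto
  then have "point_above T (j, i) \<noteq> point_left T (j, i)"
    using T unfolding tree_like_def by blast
  then show "point_above (transpose_tableau T) p \<noteq> point_left (transpose_tableau T) p"
    using ij by simp
next
  fix i assume "i \<in> fst ` cells (transpose_tableau T)"
  then obtain j where "(j, i) \<in> cells T"
    by auto
  then obtain j' where "(j', i) \<in> points T"
    by (rule tree_like_col[OF T])
  then show "\<exists>j. (i, j) \<in> points (transpose_tableau T)"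
    by auto
next
  fix j assume "j \<in> snd ` cells (transpose_tableau T)"
  then obtain i where "(j, i) \<in> cells T"
    by auto
  then obtain i' where "(j, i') \<in> points T"
    by (rule tree_like_row[OF T])
  then show "\<exists>i. (i, j) \<in> points (transpose_tableau T)"
    by auto
qed

lemma insert_line_Col_Bottom:
  "insert_line T (Col_Bottom c) = transpose_tableau (insert_line (transpose_tableau T) (Row_End c))"
proof -
  have shift: "shift_cell (cells T) (Col_Bottom c) p =
      prod.swap (shift_cell (cells (transpose_tableau T)) (Row_End c) (prod.swap p))" for p
    by (cases p) simp
  have "cells (insert_line T (Col_Bottom c)) =
      prod.swap ` cells (insert_line (transpose_tableau T) (Row_End c))"
    unfolding insert_line_def tableau.select_convs image_Un image_image cells_transpose shift
    by (simp add: product_swap flip: cells_transpose)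
  moreover have "points (insert_line T (Col_Bottom c)) =
      prod.swap ` points (insert_line (transpose_tableau T) (Row_End c))"
    unfolding insert_line_def tableau.select_convs image_insert image_image points_transpose shift
    by simp
  ultimately show ?thesis
    by (simp add: transpose_tableau_def)
qed

lemma insert_line_props:
  assumes T: "tree_like T" and e: "valid_edge (cells T) e"
  shows tree_like_insert_line: "tree_like (insert_line T e)"
    and corner_insert_line: "corner_point (insert_line T e) (new_point (cells T) e)"
    and card_points_insert_line: "card (points (insert_line T e)) = Suc (card (points T))"
    and cr_insert_line: "cr (insert_line T e) = cr T"
    and num_rows_insert_line: "num_rows (cells (insert_line T e)) =
      num_rows (cells T) + (case e of Row_End r \<Rightarrow> 0 | Col_Bottom c \<Rightarrow> 1)"
    and row_len_insert_line: "row_len (cells (insert_line T e)) 0 =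
      row_len (cells T) 0 + (case e of Row_End r \<Rightarrow> 1 | Col_Bottom c \<Rightarrow> 0)"
    and point_left_insert_line: "point_left (insert_line T e) (new_point (cells T) e) \<longleftrightarrow>
      (\<exists>r. e = Row_End r)"
proof -
  have "tree_like (insert_line T e) \<and> corner_point (insert_line T e) (new_point (cells T) e) \<and>
    card (points (insert_line T e)) = Suc (card (points T)) \<and> cr (insert_line T e) = cr T \<and>
    num_rows (cells (insert_line T e)) =
      num_rows (cells T) + (case e of Row_End r \<Rightarrow> 0 | Col_Bottom c \<Rightarrow> 1) \<and>
    row_len (cells (insert_line T e)) 0 =
      row_len (cells T) 0 + (case e of Row_End r \<Rightarrow> 1 | Col_Bottom c \<Rightarrow> 0) \<and>
    (point_left (insert_line T e) (new_point (cells T) e) \<longleftrightarrow> (\<exists>r. e = Row_End r))"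
  proof (cases e)
    case (Row_End r)
    interpret column_insertion T r
      using T e Row_End by unfold_locales simp_all
    have "num_rows (cells T') = num_rows F"
      using rows_insert num_rows_col_len[OF F] num_rows_col_len[OF ferrers_insert]
      by (simp add: col_len_def)
    then show ?thesis
      using tree_like_insert corner_insert card_points_insert cr_insert row_len_insert
        point_left_new Row_End by simp
  next
    case (Col_Bottom c)
    note F0 = tree_like_ferrers[OF T]
    interpret column_insertion "transpose_tableau T" c
      using tree_like_transpose[OF T] e Col_Bottom by unfold_locales simp_all
    have eq: "insert_line T e = transpose_tableau T'"
      using Col_Bottom insert_line_Col_Bottom by simp
    have F': "ferrers (cells (insert_line T e))"
      unfolding eq by (rule ferrers_transpose[OF ferrers_insert])
    have "row_len (cells (insert_line T e)) 0 = row_len (cells T) 0"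
      using rows_insert by (simp add: eq col_len_def row_len_def)
    moreover have "num_rows (cells (insert_line T e)) = Suc (num_rows (cells T))"
      using row_len_insert num_rows_col_len[OF F'] num_rows_col_len[OF F0]
      by (simp add: eq)
    ultimately show ?thesis
      using tree_like_transpose[OF tree_like_insert] corner_point_transpose[OF corner_insert]
        card_points_insert cr_insert not_point_above_new[of c] Col_Bottom unfolding eq by simp
  qed
  then show "tree_like (insert_line T e)"
    "corner_point (insert_line T e) (new_point (cells T) e)"
    "card (points (insert_line T e)) = Suc (card (points T))"
    "cr (insert_line T e) = cr T"
    "num_rows (cells (insert_line T e)) =
      num_rows (cells T) + (case e of Row_End r \<Rightarrow> 0 | Col_Bottom c \<Rightarrow> 1)"
    "row_len (cells (insert_line T e)) 0 =
      row_len (cells T) 0 + (case e of Row_End r \<Rightarrow> 1 | Col_Bottom c \<Rightarrow> 0)"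
    "point_left (insert_line T e) (new_point (cells T) e) \<longleftrightarrow> (\<exists>r. e = Row_End r)"
    by blast+
qed

text \<open>A point other than the root has a point to its left or one above it, but not both. This
  decides whether a column or a row is to be deleted.\<close>

lemma insert_line_surj:
  assumes T': "tree_like T'" and corner: "corner_point T' p" and "p \<noteq> (0, 0)"
  shows "\<exists>T e. tree_like T \<and> valid_edge (cells T) e \<and> insert_line T e = T' \<and> new_point (cells T) e = p"
proof -
  obtain i j where ij: "p = (i, j)"
    by fastforce
  have "p \<in> points T' - {(0, 0)}"
    using corner assms(3) by (simp add: corner_point_def lowest_def)
  then have "point_above T' (i, j) \<noteq> point_left T' (i, j)"
    using T' ij unfolding tree_like_def by blast
  then consider (left) "point_left T' (i, j)" "\<not> point_above T' (i, j)"
    | (above) "point_above T' (i, j)" "\<not> point_left T' (i, j)"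
    by blast
  then show ?thesis
  proof cases
    case left
    obtain T where "tree_like T" "(i, 0) \<in> cells T" "row_len (cells T) i = j"
      "insert_line T (Row_End i) = T'"
      using column_deletion[OF T' _ left] corner ij by blast
    then show ?thesis
      using ij by (intro exI[of _ T] exI[of _ "Row_End i"]) simp
  next
    case above
    obtain T where T: "tree_like T" "(j, 0) \<in> cells T" "row_len (cells T) j = i"
      "insert_line T (Row_End j) = transpose_tableau T'"
      using column_deletion[OF tree_like_transpose[OF T'], of j i] corner_point_transpose corner ij above
      by auto
    then have "insert_line (transpose_tableau T) (Col_Bottom j) = T'"
      by (simp add: insert_line_Col_Bottom)
    then show ?thesis
      using ij T tree_like_transpose[OF T(1)]
      by (intro exI[of _ "transpose_tableau T"] exI[of _ "Col_Bottom j"]) simp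
  qed
qed

lemma insert_line_inj:
  assumes T1: "tree_like T1" "valid_edge (cells T1) e1" and T2: "tree_like T2" "valid_edge (cells T2) e2"
    and eq: "insert_line T1 e1 = insert_line T2 e2"
    and np: "new_point (cells T1) e1 = new_point (cells T2) e2"
  shows "T1 = T2 \<and> e1 = e2"
proof -
  \<comment> \<open>The kind of the inserted line can be read off from the position of the parent of
    the new point.\<close>
  have same: "(\<exists>r. e1 = Row_End r) \<longleftrightarrow> (\<exists>r. e2 = Row_End r)"
    using point_left_insert_line[OF T1] point_left_insert_line[OF T2] eq np by simp
  show ?thesis
  proof (cases e1)
    case (Row_End r)
    then obtain r' where e2: "e2 = Row_End r'"
      using same by blast
    with Row_End np have r: "r' = r" "row_len (cells T1) r = row_len (cells T2) r"
      by auto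
    have "column_insertion T1 r" "column_insertion T2 r"
      using T1 T2 Row_End e2 r by (auto simp: column_insertion_def)
    then show ?thesis
      using column_insertion_inj eq r Row_End e2 by blast
  next
    case (Col_Bottom c)
    then obtain c' where e2: "e2 = Col_Bottom c'"
      using same by (cases e2) auto
    with Col_Bottom np have c: "c' = c" "col_len (cells T1) c = col_len (cells T2) c"
      by auto
    have "column_insertion (transpose_tableau T1) c" "column_insertion (transpose_tableau T2) c"
      using T1 T2 Col_Bottom e2 c tree_like_transpose by (auto simp: column_insertion_def)
    moreover have "insert_line (transpose_tableau T1) (Row_End c) =
        insert_line (transpose_tableau T2) (Row_End c)"
      using eq Col_Bottom e2 c by (simp add: insert_line_Col_Bottom)
    ultimately have "transpose_tableau T1 = transpose_tableau T2"
      using column_insertion_inj[of "transpose_tableau T1" c "transpose_tableau T2"] c by simp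
    then show ?thesis
      using Col_Bottom e2 c by simp
  qed
qed

section \<open>The special point and its position on the border path\<close>

definition special_edge :: "tableau \<Rightarrow> edge" where
  "special_edge T = Col_Bottom (snd (special T))"

definition special_index :: "tableau \<Rightarrow> nat" where
  "special_index T = edge_index (cells T) (special_edge T)"

lemma special_edge_valid: "tree_like T \<Longrightarrow> valid_edge (cells T) (special_edge T)"
  using special_lowest[of T] tree_like_points[of T "special T"]
    ferrers_down[OF tree_like_ferrers, of T "fst (special T)" "snd (special T)" 0 "snd (special T)"]
  by (simp add: special_edge_def lowest_def)

lemma special_index_int:
  assumes T: "tree_like T"
  shows "int (special_index T) = int (num_rows (cells T)) + content (special T) - 1"
proof -
  note F = tree_like_ferrers[OF T]
  have "col_len (cells T) (snd (special T)) = Suc (fst (special T))"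
    using special_lowest[OF T] tree_like_points[OF T, of "special T"]
      mem_col_len[OF F, of "fst (special T)" "snd (special T)"]
      mem_col_len[OF F, of "Suc (fst (special T))" "snd (special T)"]
    by (simp add: lowest_def)
  then show ?thesis
    using col_len_le_num_rows[OF F, of "snd (special T)"]
    by (simp add: special_index_def special_edge_def content_def)
qed

text \<open>If row \<open>r\<close> reaches the column \<open>l\<close> of the special point, the
  new column is to the right of all lowest points. Otherwise the special point moves one column to
  the right, and the unit of content gained cancels the \<open>- 1\<close>, leaving the difference
  of the two indices.\<close>

lemma special_insert_column:
  assumes T: "tree_like T" and r: "(r, 0) \<in> cells T" and e: "e = Row_End r"
  shows "if special_index T \<le> edge_index (cells T) e
    then special (insert_line T e) = new_point (cells T) e
    else special (insert_line T e) = shift_cell (cells T) e (special T) \<and>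
      special (insert_line T e) \<noteq> new_point (cells T) e \<and>
      content (special (insert_line T e)) - content (new_point (cells T) e) - 1 =
        int (special_index T) - int (edge_index (cells T) e)"
proof -
  interpret column_insertion T r
    using T r by unfold_locales
  obtain k l where kl: "special T = (k, l)"
    by fastforce
  have low: "lowest T (k, l)" and max: "\<And>q. lowest T q \<Longrightarrow> snd q \<le> l"
    using special_lowest[OF T] special_max[OF T] kl by auto
  have klF: "(k, l) \<in> F" "(Suc k, l) \<notin> F"
    using low tree_like_points[OF T] by (auto simp: lowest_def)
  have idx: "int (edge_index F e) = int (num_rows F) + int c - int r - 1"
    using e r num_rows_iff[OF F, of r] by auto
  have sidx: "int (special_index T) = int (num_rows F) + int l - int k - 1"
    using special_index_int[OF T] kl by simp
  have max': "snd q = c \<or> (\<exists>j \<le> l. snd q = bump c j)" if q: "lowest T' q" for q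
  proof -
    obtain i j where ij: "q = (i, j)"
      by fastforce
    show ?thesis
    proof (cases j c rule: bump_cases)
      case 1
      then show ?thesis
        using ij by simp
    next
      case (2 j')
      then have "lowest T (i, j')"
        using q ij by (simp add: lowest_def)
      then have "j' \<le> l"
        using max by fastforce
      then show ?thesis
        using ij 2 by auto
    qed
  qed
  show ?thesis
  proof (cases "(r, l) \<in> F")
    case True
    then have "l < c"
      using mem_r by simp
    moreover have "r \<le> k"
      using True klF(2) ferrers_down[OF F True, of "Suc k" l] by (cases "r \<le> k") auto
    moreover have "special T' = (r, c)"
    proof (rule special_eqI[OF tree_like_insert])
      show "lowest T' (r, c)"
        using corner_insert by (simp add: corner_point_def)
      show "snd q \<le> snd (r, c)" if "lowest T' q" for q
        using max'[OF that] \<open>l < c\<close> by (auto simp: bump_def)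
    qed
    ultimately show ?thesis
      using idx sidx e by simp
  next
    case False
    then have "c \<le> l"
      using mem_r by simp
    moreover have "k < r"
      using False ferrers_down[OF F klF(1), of r l] by (cases "k < r") auto
    moreover have "special T' = (k, bump c l)"
    proof (rule special_eqI[OF tree_like_insert])
      show "lowest T' (k, bump c l)"
        using low by (simp add: lowest_def)
      show "snd q \<le> snd (k, bump c l)" if "lowest T' q" for q
        using max'[OF that] \<open>c \<le> l\<close> by (auto simp: bump_def)
    qed
    ultimately show ?thesis
      using idx sidx e kl by (simp add: bump_def)
  qed
qed

text \<open>The special point is not carried along by transposition, so this is proved directly. A
  new row may cover lowest points but uncovers none, and it adds no cell in the columns after
  \<open>c\<close>.\<close>

lemma special_insert_row:
  assumes T: "tree_like T" and c: "(0, c) \<in> cells T" and e: "e = Col_Bottom c"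
  shows "if special_index T \<le> edge_index (cells T) e
    then special (insert_line T e) = new_point (cells T) e
    else special (insert_line T e) = shift_cell (cells T) e (special T) \<and>
      special (insert_line T e) \<noteq> new_point (cells T) e \<and>
      content (special (insert_line T e)) - content (new_point (cells T) e) - 1 =
        int (special_index T) - int (edge_index (cells T) e)"
proof -
  interpret tr: column_insertion "transpose_tableau T" c
    using tree_like_transpose[OF T] c by unfold_locales simp_all
  note F = tree_like_ferrers[OF T]
  have valid: "valid_edge (cells T) e"
    using c e by simp
  define T' where "T' = insert_line T e"
  define h where "h = col_len (cells T) c"
  have T'_tr: "T' = transpose_tableau tr.T'"
    by (simp add: T'_def e insert_line_Col_Bottom)
  have T': "tree_like T'" "corner_point T' (h, c)"
    using tree_like_insert_line[OF T valid] corner_insert_line[OF T valid] e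
    by (simp_all add: T'_def h_def)
  have mem [simp]: "(bump h i, j) \<in> cells T' \<longleftrightarrow> (i, j) \<in> cells T" "(h, j) \<in> cells T' \<longleftrightarrow> j \<le> c"
    "(bump h i, j) \<in> points T' \<longleftrightarrow> (i, j) \<in> points T" "(h, j) \<in> points T' \<longleftrightarrow> j = c" for i j
    using tr.cells_old[of j i] tr.cells_new[of j] tr.points_old[of j i] tr.points_new[of j]
    by (simp_all add: T'_tr h_def)
  obtain k l where kl: "special T = (k, l)"
    by fastforce
  have low: "lowest T (k, l)" and max: "\<And>q. lowest T q \<Longrightarrow> snd q \<le> l"
    using special_lowest[OF T] special_max[OF T] kl by auto
  have klF: "(k, l) \<in> cells T" "(Suc k, l) \<notin> cells T"
    using low tree_like_points[OF T] by (auto simp: lowest_def)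
  then have col_l: "col_len (cells T) l = Suc k"
    unfolding mem_col_len[OF F] by simp
  have idx: "int (edge_index (cells T) e) = int (num_rows (cells T)) + int c - int h"
    using e col_len_le_num_rows[OF F, of c] by (simp add: h_def)
  have sidx: "int (special_index T) = int (num_rows (cells T)) + int l - int k - 1"
    using special_index_int[OF T] kl by simp
  have max': "snd q = c \<or> snd q \<le> l" if q: "lowest T' q" for q
  proof -
    obtain i j where ij: "q = (i, j)"
      by fastforce
    show ?thesis
    proof (cases i h rule: bump_cases)
      case 1
      then show ?thesis
        using q ij by (simp add: lowest_def)
    next
      case (2 i')
      have "(Suc i', j) \<notin> cells T"
      proof
        assume "(Suc i', j) \<in> cells T"
        then have "(bump h (Suc i'), j) \<in> cells T'"
          by simp
        \<comment> \<open>Strict exactly when the new row comes directly below row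
          \<open>i'\<close>.\<close>
        moreover have "Suc (bump h i') \<le> bump h (Suc i')"
          by (simp add: bump_def)
        ultimately have "(Suc (bump h i'), j) \<in> cells T'"
          using ferrers_down[OF tree_like_ferrers[OF T'(1)]] by blast
        then show False
          using q ij 2 by (simp add: lowest_def)
      qed
      then have "lowest T (i', j)"
        using q ij 2 by (simp add: lowest_def)
      then show ?thesis
        using max ij by fastforce
    qed
  qed
  show ?thesis
  proof (cases "l \<le> c")
    case True
    then have "h \<le> Suc k"
      using col_len_antimono[OF F, of l c] col_l by (simp add: h_def)
    moreover have "special T' = (h, c)"
    proof (rule special_eqI[OF T'(1)])
      show "lowest T' (h, c)"
        using T'(2) by (simp add: corner_point_def)
      show "snd q \<le> snd (h, c)" if "lowest T' q" for q
        using max'[OF that] True by auto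
    qed
    moreover have "new_point (cells T) e = (h, c)"
      by (simp add: e h_def)
    ultimately show ?thesis
      unfolding T'_def[symmetric] using idx sidx True by simp
  next
    case False
    then have h: "Suc k \<le> h"
      using col_len_antimono[OF F, of c l] col_l by (simp add: h_def)
    have "special T' = (bump h k, l)"
    proof (rule special_eqI[OF T'(1)])
      \<comment> \<open>Below the special point there is either the new row, which stops at column
        \<open>c\<close> before reaching \<open>l\<close>, or the place of the old cell
        \<open>(Suc k, l)\<close> outside the diagram.\<close>
      have "Suc (bump h k) = h \<or> Suc (bump h k) = bump h (Suc k)"
        using h by (auto simp: bump_def)
      then have "(Suc (bump h k), l) \<notin> cells T'"
      proof
        assume "Suc (bump h k) = h"
        then show ?thesis
          using False by simp
      next
        assume "Suc (bump h k) = bump h (Suc k)"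
        then show ?thesis
          using klF by simp
      qed
      then show "lowest T' (bump h k, l)"
        using low by (simp add: lowest_def)
      show "snd q \<le> snd (bump h k, l)" if "lowest T' q" for q
        using max'[OF that] False by auto
    qed
    moreover have "bump h k = k"
      using h by (simp add: bump_def)
    moreover have "new_point (cells T) e = (h, c)" "shift_cell (cells T) e (k, l) = (bump h k, l)"
      by (simp_all add: e h_def)
    ultimately show ?thesis
      unfolding T'_def[symmetric] kl using idx sidx False h by simp
  qed
qed

lemma special_insert_line:
  assumes "tree_like T" "valid_edge (cells T) e"
  shows "if special_index T \<le> edge_index (cells T) e
    then special (insert_line T e) = new_point (cells T) e
    else special (insert_line T e) = shift_cell (cells T) e (special T) \<and>
      special (insert_line T e) \<noteq> new_point (cells T) e \<and>
      content (special (insert_line T e)) - content (new_point (cells T) e) - 1 =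
        int (special_index T) - int (edge_index (cells T) e)"
proof (cases e)
  case (Row_End r)
  with assms(2) have "(r, 0) \<in> cells T"
    by simp
  from special_insert_column[OF assms(1) this Row_End] show ?thesis .
next
  case (Col_Bottom c)
  with assms(2) have "(0, c) \<in> cells T"
    by simp
  from special_insert_row[OF assms(1) this Col_Bottom] show ?thesis .
qed

text \<open>\<open>Insertpoint\<close> tests the order of edges in the old tableau,
  \<open>close_at\<close> looks at the special point of the intermediate one. By
  \<open>special_insert_line\<close> the two tests agree, and so do the ends of the ribbon.\<close>

lemma Insertpoint_eq:
  assumes T: "tree_like T" and e: "valid_edge (cells T) e"
  shows "Insertpoint T e = close_at (insert_line T e) (new_point (cells T) e)"
proof -
  note F = tree_like_ferrers[OF T]
  define T' where "T' = insert_line T e"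
  obtain i j where ij: "new_point (cells T) e = (i, j)"
    by fastforce
  obtain k l where kl: "shift_cell (cells T) e (special T) = (k, l)"
    by fastforce
  have sp: "if special_index T \<le> edge_index (cells T) e then special T' = (i, j)
      else special T' = (k, l) \<and> (k, l) \<noteq> (i, j)"
    using special_insert_line[OF T e] unfolding T'_def ij kl by metis
  have ne: "(northeast_of (cells T) e (Col_Bottom (snd (special T))) \<or>
      e = Col_Bottom (snd (special T))) \<longleftrightarrow> special_index T \<le> edge_index (cells T) e"
    using northeast_of_iff[OF F e special_edge_valid[OF T]]
      edge_index_inj[OF F e special_edge_valid[OF T]]
    unfolding special_edge_def[symmetric] special_index_def
    by (auto simp: order_le_less)
  have lhs: "Insertpoint T e = (if special_index T \<le> edge_index (cells T) e then T'
      else T'\<lparr>cells := cells T' \<union> ribbon (cells T') (i, Suc j) (Suc k, l)\<rparr>)"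
    unfolding Insertpoint_def Let_def ij kl T'_def[symmetric] ne by simp
  show ?thesis
  proof (cases "special_index T \<le> edge_index (cells T) e")
    case True
    then show ?thesis
      using lhs sp ij by (simp add: T'_def[symmetric] close_at_trivial)
  next
    case False
    then have sp': "special T' = (k, l)" "(k, l) \<noteq> (i, j)"
      using sp by auto
    interpret ct: corner_tableau T' i j k l
      unfolding T'_def
    proof
      show "tree_like (insert_line T e)" "corner_point (insert_line T e) (i, j)"
        using tree_like_insert_line[OF T e] corner_insert_line[OF T e] ij by simp_all
    qed (use sp' in \<open>simp_all add: T'_def\<close>)
    show ?thesis
      using ribbon_eq_strip[OF ct.F ct.a_outer ct.b_outer ct.rc ct.kl ct.content_le]
        lhs False ct.close_at_eq ij
      by (simp add: T'_def[symmetric])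
  qed
qed

lemma Insertpoint_props:
  assumes T: "tree_like T" and e: "valid_edge (cells T) e"
  shows tree_like_Insertpoint: "tree_like (Insertpoint T e)"
    and tsize_Insertpoint: "tsize (Insertpoint T e) = Suc (tsize T)"
    and special_Insertpoint: "special (Insertpoint T e) = new_point (cells T) e"
    and special_index_Insertpoint: "special_index (Insertpoint T e) = edge_index (cells T) e"
    and cr_Insertpoint: "cr (Insertpoint T e) = cr T + (special_index T - edge_index (cells T) e)"
    and length_boundary_Insertpoint:
      "length (boundary (cells (Insertpoint T e))) = Suc (length (boundary (cells T)))"
proof -
  note eq = Insertpoint_eq[OF T e]
  note F = tree_like_ferrers[OF T]
  note T' = tree_like_insert_line[OF T e] corner_insert_line[OF T e]
  show T'': "tree_like (Insertpoint T e)"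
    unfolding eq by (rule tree_like_close_at[OF T'])
  show "tsize (Insertpoint T e) = Suc (tsize T)"
    using card_points_insert_line[OF T e] by (simp add: tsize_def eq)
  show sp: "special (Insertpoint T e) = new_point (cells T) e"
    unfolding eq by (rule special_close_at[OF T'])
  have R: "num_rows (cells (Insertpoint T e)) = num_rows (cells (insert_line T e))"
    unfolding num_rows_col_len[OF tree_like_ferrers[OF T'']] num_rows_col_len[OF tree_like_ferrers[OF T'(1)]]
    by (simp add: col_len_def eq rows_close_at[OF T'])
  have L: "row_len (cells (Insertpoint T e)) 0 = row_len (cells (insert_line T e)) 0"
    by (simp add: row_len_def eq cols_close_at[OF T'])
  \<comment> \<open>The left side is the index of the bottom edge below the new point. For a row
    insertion the new point lies one row below the old bottom cell, which the additional row
    compensates.\<close>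
  have "int (num_rows (cells T) + (case e of Row_End r \<Rightarrow> 0 | Col_Bottom c \<Rightarrow> 1)) +
      content (new_point (cells T) e) - 1 = int (edge_index (cells T) e)"
  proof (cases e)
    case (Row_End r)
    then show ?thesis
      using e num_rows_iff[OF F, of r] by auto
  next
    case (Col_Bottom c)
    then show ?thesis
      using col_len_le_num_rows[OF F, of c] by simp
  qed
  then have "int (special_index (Insertpoint T e)) = int (edge_index (cells T) e)"
    unfolding special_index_int[OF T''] sp R num_rows_insert_line[OF T e] .
  then show "special_index (Insertpoint T e) = edge_index (cells T) e"
    by simp
  \<comment> \<open>Truncation covers the case without ribbon; otherwise
    \<open>special_insert_line\<close> turns the number of ribbon cells into the difference of
    indices.\<close>
  have "int (cr (Insertpoint T e)) = int (cr T + (special_index T - edge_index (cells T) e))"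
    unfolding eq cr_close_at[OF T'] cr_insert_line[OF T e]
    using special_insert_line[OF T e] by (smt (verit) of_nat_add of_nat_diff diff_is_0_eq of_nat_0 linorder_le_cases)
  then show "cr (Insertpoint T e) = cr T + (special_index T - edge_index (cells T) e)"
    by simp
  show "length (boundary (cells (Insertpoint T e))) = Suc (length (boundary (cells T)))"
    unfolding length_boundary[OF F] length_boundary[OF tree_like_ferrers[OF T'']] R L
      num_rows_insert_line[OF T e] row_len_insert_line[OF T e]
    by (cases e) auto
qed

text \<open>The special point of the result is the new point. So both intermediate tableaux were
  closed at the same cell, and the ribbon and the line can be cancelled in turn.\<close>

lemma Insertpoint_inj:
  assumes "tree_like T1" "valid_edge (cells T1) e1" "tree_like T2" "valid_edge (cells T2) e2"
    and eq: "Insertpoint T1 e1 = Insertpoint T2 e2"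
  shows "T1 = T2 \<and> e1 = e2"
proof -
  have np: "new_point (cells T1) e1 = new_point (cells T2) e2"
    using special_Insertpoint[OF assms(1,2)] special_Insertpoint[OF assms(3,4)] eq by simp
  have "insert_line T1 e1 = insert_line T2 e2"
  proof (rule close_at_inj)
    show "close_at (insert_line T1 e1) (new_point (cells T1) e1) =
        close_at (insert_line T2 e2) (new_point (cells T1) e1)"
      using Insertpoint_eq[OF assms(1,2)] Insertpoint_eq[OF assms(3,4)] eq np by simp
    show "corner_point (insert_line T2 e2) (new_point (cells T1) e1)"
      unfolding np by (rule corner_insert_line[OF assms(3,4)])
    show "corner_point (insert_line T1 e1) (new_point (cells T1) e1)"
      by (rule corner_insert_line[OF assms(1,2)])
  qed (use assms tree_like_insert_line in blast)+
  then show ?thesis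
    using insert_line_inj[OF assms(1-4)] np by blast
qed

text \<open>Needed to see that the root is never the point to delete in size above 1.\<close>

lemma corner_origin:
  assumes T: "tree_like T" and "corner_point T (0, 0)"
  shows "points T = {(0, 0)}"
proof -
  note down = ferrers_down[OF tree_like_ferrers[OF T]]
  have no: "(Suc 0, 0) \<notin> cells T" "(0, Suc 0) \<notin> cells T" and p: "(0, 0) \<in> points T"
    using assms(2) by (auto simp: corner_point_def lowest_def)
  have "x = (0, 0)" if "x \<in> cells T" for x
    using that no down[of "fst x" "snd x" "Suc 0" 0] down[of "fst x" "snd x" 0 "Suc 0"]
    by (cases x) (auto simp: Suc_le_eq)
  then show ?thesis
    using p tree_like_points[OF T] by blast
qed

lemma Insertpoint_surj:
  assumes T': "tree_like T'" and "tsize T' \<noteq> 1"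
  shows "\<exists>T e. tree_like T \<and> valid_edge (cells T) e \<and> Insertpoint T e = T'"
proof -
  obtain T0 where T0: "tree_like T0" "corner_point T0 (special T')" "close_at T0 (special T') = T'"
    using close_at_surj[OF T'] by blast
  have "special T' \<noteq> (0, 0)"
  proof
    assume "special T' = (0, 0)"
    then have "points T0 = {(0, 0)}"
      using corner_origin T0 by metis
    moreover have "points T' = points T0"
      using arg_cong[OF T0(3), of points] by simp
    ultimately show False
      using assms(2) by (simp add: tsize_def)
  qed
  then obtain T e where Te: "tree_like T" "valid_edge (cells T) e" "insert_line T e = T0"
    "new_point (cells T) e = special T'"
    using insert_line_surj[OF T0(1,2)] by blast
  then have "Insertpoint T e = T'"
    using Insertpoint_eq[OF Te(1,2)] T0(3) by simp
  with Te show ?thesis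
    by blast
qed

section \<open>Histories and codes\<close>

definition insert_at :: "tableau \<Rightarrow> nat \<Rightarrow> tableau" where
  "insert_at T j = Insertpoint T (boundary (cells T) ! j)"

lemma tree_like_unit: "tree_like unit_tableau"
proof -
  have "ferrers {(0, 0)}"
    by (rule ferrersI) auto
  then show ?thesis
    by (simp add: unit_tableau_def tree_like_def)
qed

lemma TLT_1: "TLT 1 = {unit_tableau}"
proof
  show "{unit_tableau} \<subseteq> TLT 1"
    using tree_like_unit by (simp add: TLT_def tsize_def unit_tableau_def)
  show "TLT 1 \<subseteq> {unit_tableau}"
  proof
    fix T assume "T \<in> TLT 1"
    then have T: "tree_like T" "card (points T) = 1"
      by (auto simp: TLT_def tsize_def)
    moreover have "(0, 0) \<in> points T"
      using T by (simp add: tree_like_def)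
    ultimately have P: "points T = {(0, 0)}"
      by (metis card_1_singletonE singletonD)
    have "x = (0, 0)" if x: "x \<in> cells T" for x
    proof -
      obtain i j where ij: "x = (i, j)"
        by fastforce
      obtain j' where "(i, j') \<in> points T"
        using tree_like_row[OF T(1)] x ij by blast
      moreover obtain i' where "(i', j) \<in> points T"
        using tree_like_col[OF T(1)] x ij by blast
      ultimately show ?thesis
        using P ij by simp
    qed
    then have "cells T = {(0, 0)}"
      using P tree_like_points[OF T(1)] by blast
    with P show "T \<in> {unit_tableau}"
      by (simp add: unit_tableau_def)
  qed
qed

lemma TLT_Suc_surj:
  assumes "n \<ge> 1" and T': "T' \<in> TLT (Suc n)"
  obtains T e where "T \<in> TLT n" "valid_edge (cells T) e" "Insertpoint T e = T'"
proof -
  obtain T e where Te: "tree_like T" "valid_edge (cells T) e" "Insertpoint T e = T'"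
    using Insertpoint_surj[of T'] T' assms(1) by (auto simp: TLT_def)
  moreover have "tsize T = n"
    using tsize_Insertpoint[OF Te(1,2)] Te(3) T' by (simp add: TLT_def)
  ultimately show thesis
    using that by (simp add: TLT_def)
qed

lemma TLT_Insertpoint:
  "T \<in> TLT n \<Longrightarrow> valid_edge (cells T) e \<Longrightarrow> Insertpoint T e \<in> TLT (Suc n)"
  using tree_like_Insertpoint tsize_Insertpoint by (simp add: TLT_def)

lemma TLT_length_boundary:
  assumes "n \<ge> 1" "T \<in> TLT n"
  shows "length (boundary (cells T)) = Suc n"
  using assms
proof (induction n arbitrary: T rule: nat_induct_at_least)
  case base
  have F: "ferrers {(0 :: nat, 0 :: nat)}"
    using tree_like_ferrers[OF tree_like_unit] by (simp add: unit_tableau_def)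
  have "row_len {(0, 0)} 0 = 1"
    by (rule row_len_eqI) auto
  then show ?case
    using base TLT_1 length_boundary[OF F] by (simp add: unit_tableau_def num_rows_def)
next
  case (Suc n)
  obtain S e where "S \<in> TLT n" "valid_edge (cells S) e" "Insertpoint S e = T"
    using TLT_Suc_surj[OF Suc.hyps Suc.prems] .
  then show ?case
    using Suc.IH length_boundary_Insertpoint[of S e] by (auto simp: TLT_def)
qed

lemma insert_at_edge:
  assumes "n \<ge> 1" "T \<in> TLT n" "j \<le> n"
  shows "valid_edge (cells T) (boundary (cells T) ! j)"
    and "edge_index (cells T) (boundary (cells T) ! j) = j"
  using boundary_nth_valid[OF tree_like_ferrers, of T j] TLT_length_boundary[OF assms(1,2)] assms
  by (auto simp: TLT_def)

lemma insert_at_TLT: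
  "n \<ge> 1 \<Longrightarrow> T \<in> TLT n \<Longrightarrow> j \<le> n \<Longrightarrow> insert_at T j \<in> TLT (Suc n)"
  unfolding insert_at_def by (intro TLT_Insertpoint insert_at_edge)

lemma special_index_insert_at:
  "n \<ge> 1 \<Longrightarrow> T \<in> TLT n \<Longrightarrow> j \<le> n \<Longrightarrow> special_index (insert_at T j) = j"
  using special_index_Insertpoint[of T "boundary (cells T) ! j"] insert_at_edge[of n T j]
  by (simp add: TLT_def insert_at_def)

lemma cr_insert_at:
  "n \<ge> 1 \<Longrightarrow> T \<in> TLT n \<Longrightarrow> j \<le> n \<Longrightarrow> cr (insert_at T j) = cr T + (special_index T - j)"
  using cr_Insertpoint[of T "boundary (cells T) ! j"] insert_at_edge[of n T j]
  by (simp add: TLT_def insert_at_def)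

lemma insert_at_surj:
  assumes n: "n \<ge> 1" and T': "T' \<in> TLT (Suc n)"
  obtains T j where "T \<in> TLT n" "j \<le> n" "T' = insert_at T j"
proof -
  obtain T e where Te: "T \<in> TLT n" "valid_edge (cells T) e" "Insertpoint T e = T'"
    using TLT_Suc_surj[OF n T'] .
  have "ferrers (cells T)"
    using Te(1) tree_like_ferrers by (simp add: TLT_def)
  note nth = nth_boundary[OF this Te(2)]
  show thesis
  proof (rule that[OF Te(1)])
    show "edge_index (cells T) e \<le> n"
      using nth(1) TLT_length_boundary[OF n Te(1)] by simp
    show "T' = insert_at T (edge_index (cells T) e)"
      by (simp add: insert_at_def nth(2) Te(3))
  qed
qed

lemma insert_at_inj:
  assumes "n \<ge> 1" "T1 \<in> TLT n" "j1 \<le> n" "T2 \<in> TLT n" "j2 \<le> n" "insert_at T1 j1 = insert_at T2 j2"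
  shows "T1 = T2 \<and> j1 = j2"
proof -
  have "T1 = T2 \<and> boundary (cells T1) ! j1 = boundary (cells T2) ! j2"
  proof (rule Insertpoint_inj)
    show "tree_like T1" "tree_like T2"
      using assms by (simp_all add: TLT_def)
  qed (use assms insert_at_edge(1) insert_at_def in auto)
  then show ?thesis
    using insert_at_edge(2)[OF assms(1-3)] insert_at_edge(2)[OF assms(1,4,5)] by metis
qed

text \<open>A tableau of size \<open>n\<close> has \<open>n + 1\<close> edges, and the insertions at
  them reach every tableau of the next size exactly once.\<close>

lemma card_TLT:
  assumes "n \<ge> 1"
  shows "finite (TLT n) \<and> card (TLT n) = fact n"
  using assms
proof (induction n rule: nat_induct_at_least)
  case base
  then show ?case
    using TLT_1 by simp
next
  case (Suc n)
  have "bij_betw (\<lambda>(T, j). insert_at T j) (TLT n \<times> {..n}) (TLT (Suc n))"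
    unfolding bij_betw_def
  proof
    show "inj_on (\<lambda>(T, j). insert_at T j) (TLT n \<times> {..n})"
      using insert_at_inj[OF Suc.hyps] by (auto simp: inj_on_def)
    show "(\<lambda>(T, j). insert_at T j) ` (TLT n \<times> {..n}) = TLT (Suc n)"
    proof
      show "TLT (Suc n) \<subseteq> (\<lambda>(T, j). insert_at T j) ` (TLT n \<times> {..n})"
      proof
        fix T' assume "T' \<in> TLT (Suc n)"
        then obtain T j where "T \<in> TLT n" "j \<le> n" "T' = insert_at T j"
          by (rule insert_at_surj[OF Suc.hyps])
        then show "T' \<in> (\<lambda>(T, j). insert_at T j) ` (TLT n \<times> {..n})"
          by (intro image_eqI[of _ _ "(T, j)"]) auto
      qed
    qed (use insert_at_TLT[OF Suc.hyps] in auto)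
  qed
  from bij_betw_finite[OF this] bij_betw_same_card[OF this] show ?case
    using Suc.IH by (simp add: card_cartesian_product mult.commute)
qed

section \<open>Uniqueness of the history and recursion for the code\<close>

lemma is_history_TLT:
  assumes "is_history T Ts" "k < length Ts"
  shows "Ts ! k \<in> TLT (Suc k)"
  using assms(2)
proof (induction k)
  case 0
  have "Ts ! 0 = unit_tableau"
    using assms(1) by (auto simp: is_history_def hd_conv_nth)
  then show ?case
    using TLT_1 by simp
next
  case (Suc k)
  then have Tk: "Ts ! k \<in> TLT (Suc k)"
    by simp
  obtain e where e: "e \<in> set (boundary (cells (Ts ! k)))" "Ts ! Suc k = Insertpoint (Ts ! k) e"
    using assms(1) Suc.prems by (auto simp: is_history_def)
  have "ferrers (cells (Ts ! k))"
    using Tk tree_like_ferrers by (simp add: TLT_def)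
  then show ?case
    using e TLT_Insertpoint[OF Tk] by (simp add: set_boundary)
qed

text \<open>Injectivity of \<open>Insertpoint\<close> forces the last entry but one to be
  \<open>T\<close>. Uniqueness of histories, and with it the meaning of \<open>history\<close>,
  follows by induction.\<close>

lemma is_history_insert_at:
  assumes n: "n \<ge> 1" and T: "T \<in> TLT n" and j: "j \<le> n"
  shows "is_history (insert_at T j) Ts \<longleftrightarrow> (\<exists>Ts0. Ts = Ts0 @ [insert_at T j] \<and> is_history T Ts0)"
proof
  assume H: "is_history (insert_at T j) Ts"
  then have len: "length Ts = Suc n" and ne: "Ts \<noteq> []" and last: "last Ts = insert_at T j"
    using insert_at_TLT[OF n T j] by (auto simp: is_history_def TLT_def)
  define Ts0 where "Ts0 = butlast Ts"
  have Ts: "Ts = Ts0 @ [insert_at T j]"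
    using append_butlast_last_id[OF ne] last by (simp add: Ts0_def)
  have len0: "length Ts0 = n"
    using len by (simp add: Ts0_def)
  then have ne0: "Ts0 \<noteq> []"
    using n by auto
  obtain m where m: "n = Suc m"
    using n by (cases n) auto
  have nth: "Ts ! m = last Ts0" "Ts ! Suc m = insert_at T j"
    using m len0 ne0 Ts by (auto simp: nth_append last_conv_nth)
  have S: "last Ts0 \<in> TLT n"
    using is_history_TLT[OF H, of m] len m nth by simp
  have "\<exists>e \<in> set (boundary (cells (last Ts0))). insert_at T j = Insertpoint (last Ts0) e"
  proof -
    have "Suc m < length Ts"
      using len m by simp
    then have "\<exists>e \<in> set (boundary (cells (Ts ! m))). Ts ! Suc m = Insertpoint (Ts ! m) e"
      using H unfolding is_history_def by blast
    then show ?thesis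
      unfolding nth .
  qed
  then obtain e where e: "valid_edge (cells (last Ts0)) e" "insert_at T j = Insertpoint (last Ts0) e"
    using set_boundary[of "cells (last Ts0)"] S tree_like_ferrers by (auto simp: TLT_def)
  have "T = last Ts0"
    using Insertpoint_inj[of T "boundary (cells T) ! j" "last Ts0" e] insert_at_edge[OF n T j] e S T
    by (simp add: TLT_def insert_at_def)
  moreover have "(\<exists>e \<in> set (boundary (cells (Ts0 ! k))). Ts0 ! Suc k = Insertpoint (Ts0 ! k) e)"
    if "Suc k < length Ts0" for k
  proof -
    have "\<exists>e \<in> set (boundary (cells (Ts ! k))). Ts ! Suc k = Insertpoint (Ts ! k) e"
      using H that Ts by (auto simp: is_history_def)
    then show ?thesis
      using that Ts by (simp add: nth_append)
  qed
  moreover have "hd Ts0 = unit_tableau"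
    using H Ts ne0 by (simp add: is_history_def)
  ultimately have "is_history T Ts0"
    using len0 ne0 T by (simp add: is_history_def TLT_def)
  with Ts show "\<exists>Ts0. Ts = Ts0 @ [insert_at T j] \<and> is_history T Ts0"
    by blast
next
  assume "\<exists>Ts0. Ts = Ts0 @ [insert_at T j] \<and> is_history T Ts0"
  then obtain Ts0 where Ts: "Ts = Ts0 @ [insert_at T j]" and H: "is_history T Ts0"
    by blast
  have len0: "length Ts0 = n" and ne0: "Ts0 \<noteq> []"
    using H T by (auto simp: is_history_def TLT_def)
  have "\<exists>e \<in> set (boundary (cells (Ts ! k))). Ts ! Suc k = Insertpoint (Ts ! k) e"
    if k: "Suc k < length Ts" for k
  proof (cases "Suc k < length Ts0")
    case True
    then have "\<exists>e \<in> set (boundary (cells (Ts0 ! k))). Ts0 ! Suc k = Insertpoint (Ts0 ! k) e"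
      using H by (simp add: is_history_def)
    then show ?thesis
      using True Ts by (simp add: nth_append)
  next
    case False
    then have "Suc k = length Ts0"
      using k Ts by simp
    then have k': "k = length Ts0 - 1" "k < length Ts0" and Suc_k: "Ts ! Suc k = insert_at T j"
      using Ts by auto
    have "Ts ! k = Ts0 ! k"
      using Ts k'(2) by (simp add: nth_append)
    also have "\<dots> = last Ts0"
      unfolding k'(1) by (rule last_conv_nth[OF ne0, symmetric])
    also have "\<dots> = T"
      using H by (simp add: is_history_def)
    finally have "Ts ! k = T" .
    moreover note Suc_k
    moreover have "boundary (cells T) ! j \<in> set (boundary (cells T))"
      using TLT_length_boundary[OF n T] j by simp
    ultimately show ?thesis
      by (auto simp: insert_at_def)
  qed
  moreover have "hd Ts = unit_tableau"
    using H Ts ne0 by (simp add: is_history_def)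
  ultimately show "is_history (insert_at T j) Ts"
    using insert_at_TLT[OF n T j] len0 Ts by (simp add: is_history_def TLT_def)
qed

lemma ex1_history:
  assumes "n \<ge> 1" "T \<in> TLT n"
  shows "\<exists>!Ts. is_history T Ts"
  using assms
proof (induction n arbitrary: T rule: nat_induct_at_least)
  case base
  then have T: "T = unit_tableau" "tsize T = 1"
    using TLT_1 by (auto simp: TLT_def)
  have "is_history T Ts \<longleftrightarrow> Ts = [unit_tableau]" for Ts
    using T by (cases Ts) (auto simp: is_history_def)
  then show ?case
    by simp
next
  case (Suc n)
  obtain S j where "S \<in> TLT n" "j \<le> n" "T = insert_at S j"
    using insert_at_surj[OF Suc.hyps Suc.prems] .
  then show ?case
    using Suc.IH[of S] is_history_insert_at[OF Suc.hyps, of S j] by auto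
qed

lemma is_history_history:
  assumes "n \<ge> 1" "T \<in> TLT n"
  shows "is_history T (history T)"
  unfolding history_def by (rule theI'[OF ex1_history[OF assms]])

lemma history_insert_at:
  assumes n: "n \<ge> 1" and T: "T \<in> TLT n" and j: "j \<le> n"
  shows "history (insert_at T j) = history T @ [insert_at T j]"
proof -
  have "is_history (insert_at T j) (history T @ [insert_at T j])"
    using is_history_insert_at[OF assms] is_history_history[OF n T] by blast
  then show ?thesis
    using is_history_history[of "Suc n"] ex1_history[of "Suc n"] insert_at_TLT[OF assms] by auto
qed

lemma hist_insert_at:
  assumes n: "n \<ge> 1" and T: "T \<in> TLT n" and j: "j \<le> n"
  shows "1 \<le> i \<Longrightarrow> i \<le> n \<Longrightarrow> hist (insert_at T j) i = hist T i"
    and "hist (insert_at T j) (Suc n) = insert_at T j"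
    and "hist T n = T"
proof -
  have "length (history T) = n" "last (history T) = T" "history T \<noteq> []"
    using is_history_history[OF n T] T by (auto simp: is_history_def TLT_def)
  then show "1 \<le> i \<Longrightarrow> i \<le> n \<Longrightarrow> hist (insert_at T j) i = hist T i"
    "hist (insert_at T j) (Suc n) = insert_at T j" "hist T n = T"
    using history_insert_at[OF assms] by (auto simp: hist_def nth_append last_conv_nth)
qed

lemma ins_index_insert_at:
  assumes n: "n \<ge> 1" and T: "T \<in> TLT n" and j: "j \<le> n"
  shows "1 \<le> i \<Longrightarrow> i \<le> n \<Longrightarrow> ins_index (insert_at T j) i = ins_index T i"
    and "ins_index (insert_at T j) (Suc n) = j"
proof -
  show "ins_index (insert_at T j) i = ins_index T i" if "1 \<le> i" "i \<le> n"
    using hist_insert_at(1)[OF assms, of i] hist_insert_at(1)[OF assms, of "i - 1"] that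
    by (auto simp: ins_index_def)
  have "(THE j'. j' < length (boundary (cells T)) \<and>
      insert_at T j = Insertpoint T (boundary (cells T) ! j')) = j"
  proof (rule the_equality)
    show "j < length (boundary (cells T)) \<and> insert_at T j = Insertpoint T (boundary (cells T) ! j)"
      using TLT_length_boundary[OF n T] j by (simp add: insert_at_def)
    fix j' assume "j' < length (boundary (cells T)) \<and>
      insert_at T j = Insertpoint T (boundary (cells T) ! j')"
    then show "j' = j"
      using insert_at_inj[OF n T j T, of j'] TLT_length_boundary[OF n T] by (simp add: insert_at_def)
  qed
  moreover have "hist (insert_at T j) n = T"
    using hist_insert_at(1)[OF assms n order_refl] hist_insert_at(3)[OF assms] by simp
  ultimately show "ins_index (insert_at T j) (Suc n) = j"
    using hist_insert_at(2)[OF assms] n by (simp add: ins_index_def)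
qed

text \<open>This bound keeps the list access in \<open>perm_of_code\<close> within range.\<close>

lemma ins_index_less:
  assumes "n \<ge> 1" "T \<in> TLT n" "1 \<le> i" "i \<le> n"
  shows "ins_index T i < i"
  using assms
proof (induction n arbitrary: T rule: nat_induct_at_least)
  case base
  then show ?case
    by (simp add: ins_index_def)
next
  case (Suc n)
  obtain S j where S: "S \<in> TLT n" "j \<le> n" "T = insert_at S j"
    using insert_at_surj[OF Suc.hyps Suc.prems(1)] .
  then show ?case
    using Suc.IH[of S] ins_index_insert_at[OF Suc.hyps S(1,2)] Suc.prems
    by (cases "i = Suc n") auto
qed

text \<open>In size 1 the code entry 0 is a convention, and it is also the index of the bottom edge
  of the single cell.\<close>

lemma special_index_eq_ins_index:
  assumes "n \<ge> 1" "T \<in> TLT n"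
  shows "special_index T = ins_index T n"
proof (cases "n = 1")
  case True
  then have T: "T = unit_tableau"
    using assms TLT_1 by simp
  then have "special T = (0, 0)"
    using special_lowest[OF tree_like_unit] by (simp add: lowest_def unit_tableau_def)
  then show ?thesis
    using special_index_int[OF tree_like_unit] T True
    by (simp add: ins_index_def num_rows_def unit_tableau_def)
next
  case False
  then obtain m where m: "n = Suc m" "m \<ge> 1"
    using assms(1) by (cases n) auto
  obtain S j where "S \<in> TLT m" "j \<le> m" "T = insert_at S j"
    using insert_at_surj[OF m(2)] assms(2) m(1) by metis
  then show ?thesis
    using special_index_insert_at[OF m(2)] ins_index_insert_at(2)[OF m(2)] m(1) by simp
qed

text \<open>The crossings added by a step depend on the index of the previous special point, which
  is the previous code entry; hence differences of consecutive entries.\<close>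

lemma cr_eq_sum:
  assumes "n \<ge> 1" "T \<in> TLT n"
  shows "cr T = (\<Sum>i = 1..<n. ins_index T i - ins_index T (Suc i))"
  using assms
proof (induction n arbitrary: T rule: nat_induct_at_least)
  case base
  then have "T = unit_tableau"
    using TLT_1 by simp
  then have "crossings T = {}"
    by (auto simp: crossings_def unit_tableau_def)
  then show ?case
    by (simp add: cr_def)
next
  case (Suc n)
  obtain S j where S: "S \<in> TLT n" "j \<le> n" "T = insert_at S j"
    using insert_at_surj[OF Suc.hyps Suc.prems(1)] .
  note idx = ins_index_insert_at[OF Suc.hyps S(1,2), folded S(3)]
  have "cr T = cr S + (ins_index S n - j)"
    using cr_insert_at[OF Suc.hyps S(1,2)] S special_index_eq_ins_index[OF Suc.hyps S(1)] by simp
  also have "cr S = (\<Sum>i = 1..<n. ins_index T i - ins_index T (Suc i))"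
    unfolding Suc.IH[OF S(1)] by (rule sum.cong) (use idx(1) in auto)
  also have "ins_index S n - j = ins_index T n - ins_index T (Suc n)"
    using idx Suc.hyps by simp
  finally show ?case
    using Suc.hyps by simp
qed

lemma ins_index_inj:
  assumes "n \<ge> 1" "T1 \<in> TLT n" "T2 \<in> TLT n" "\<And>i. 1 \<le> i \<Longrightarrow> i \<le> n \<Longrightarrow> ins_index T1 i = ins_index T2 i"
  shows "T1 = T2"
  using assms
proof (induction n arbitrary: T1 T2 rule: nat_induct_at_least)
  case base
  then show ?case
    using TLT_1 by simp
next
  case (Suc n)
  obtain S1 j1 where S1: "S1 \<in> TLT n" "j1 \<le> n" "T1 = insert_at S1 j1"
    using insert_at_surj[OF Suc.hyps Suc.prems(1)] .
  obtain S2 j2 where S2: "S2 \<in> TLT n" "j2 \<le> n" "T2 = insert_at S2 j2"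
    using insert_at_surj[OF Suc.hyps Suc.prems(2)] .
  note idx1 = ins_index_insert_at[OF Suc.hyps S1(1,2), folded S1(3)]
  note idx2 = ins_index_insert_at[OF Suc.hyps S2(1,2), folded S2(3)]
  have "S1 = S2"
    using Suc.IH[OF S1(1) S2(1)] idx1(1) idx2(1) Suc.prems(3) by simp
  moreover have "j1 = j2"
    using idx1(2) idx2(2) Suc.prems(3)[of "Suc n"] by simp
  ultimately show ?case
    using S1 S2 by simp
qed

section \<open>Permutations and their codes\<close>

lemma card_less_nth_sorted_list_of_set:
  fixes A :: "nat set"
  assumes fin: "finite A" and m: "m < card A"
  shows "card {x \<in> A. x < sorted_list_of_set A ! m} = m"
proof -
  let ?xs = "sorted_list_of_set A"
  have len: "length ?xs = card A"
    by simp
  have less: "?xs ! i < ?xs ! j \<longleftrightarrow> i < j" if "i < card A" "j < card A" for i j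
    using strict_sorted_list_of_set[of A] that len
    by (metis linorder_neqE_nat order_less_asym' sorted_wrt_nth_less)
  have "{x \<in> A. x < ?xs ! m} = (!) ?xs ` {..<m}"
  proof
    show "{x \<in> A. x < ?xs ! m} \<subseteq> (!) ?xs ` {..<m}"
    proof
      fix x assume x: "x \<in> {x \<in> A. x < ?xs ! m}"
      then obtain i where "i < card A" "x = ?xs ! i"
        using fin len by (metis (no_types, lifting) in_set_conv_nth mem_Collect_eq set_sorted_list_of_set)
      then show "x \<in> (!) ?xs ` {..<m}"
        using x less m by auto
    qed
    show "(!) ?xs ` {..<m} \<subseteq> {x \<in> A. x < ?xs ! m}"
    proof
      fix x assume "x \<in> (!) ?xs ` {..<m}"
      then obtain i where i: "i < m" "x = ?xs ! i"
        by auto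
      then have "x \<in> set ?xs"
        using m len by simp
      then show "x \<in> {x \<in> A. x < ?xs ! m}"
        using i less[of i m] m fin by simp
    qed
  qed
  moreover have "inj_on ((!) ?xs) {..<m}"
    using m len by (auto intro!: inj_on_nth)
  ultimately show ?thesis
    by (simp add: card_image)
qed

locale insertion_code =
  fixes n :: nat and a :: "nat \<Rightarrow> nat"
  assumes a: "\<And>i. 1 \<le> i \<Longrightarrow> i \<le> n \<Longrightarrow> a i < i"
begin

abbreviation "\<sigma> \<equiv> perm_of_code n a"
abbreviation "unused i \<equiv> {1..n} - \<sigma> ` {i<..n}"

lemma code_value: "1 \<le> i \<Longrightarrow> i \<le> n \<Longrightarrow> \<sigma> i = sorted_list_of_set (unused i) ! a i"
  by (subst perm_of_code.simps) simp

lemma perm_of_code_aux: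
  assumes "i \<le> n"
  shows "inj_on \<sigma> {i<..n} \<and> \<sigma> ` {i<..n} \<subseteq> {1..n} \<and> card (unused i) = i"
  using assms
proof (induction rule: inc_induct)
  case base
  then show ?case
    by simp
next
  case (step i)
  have "a (Suc i) < card (unused (Suc i))"
    using step a[of "Suc i"] by simp
  then have "sorted_list_of_set (unused (Suc i)) ! a (Suc i) \<in> set (sorted_list_of_set (unused (Suc i)))"
    by (intro nth_mem) simp
  then have new: "\<sigma> (Suc i) \<in> unused (Suc i)"
    using code_value[of "Suc i"] step.hyps by simp
  have set: "{i<..n} = insert (Suc i) {Suc i<..n}"
    using step.hyps by auto
  have "unused i = unused (Suc i) - {\<sigma> (Suc i)}"
    unfolding set by auto
  then have "card (unused i) = i"
    using step.IH new by simp
  moreover have "inj_on \<sigma> {i<..n}" "\<sigma> ` {i<..n} \<subseteq> {1..n}"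
    unfolding set using step.IH new by (simp_all add: inj_on_insert)
  ultimately show ?case
    by blast
qed

lemma perm_of_code_permutes: "\<sigma> permutes {1..n}"
proof (rule bij_imp_permutes)
  have "{0<..n} = {1..n}"
    by auto
  then have "inj_on \<sigma> {1..n}" "\<sigma> ` {1..n} \<subseteq> {1..n}"
    using perm_of_code_aux[of 0] by simp_all
  then show "bij_betw \<sigma> {1..n} {1..n}"
    by (simp add: bij_betw_def endo_inj_surj)
  show "\<sigma> x = x" if "x \<notin> {1..n}" for x
    using that by (subst perm_of_code.simps) (simp only: if_False)
qed

lemma perm_of_code_rank:
  assumes i: "1 \<le> i" "i \<le> n"
  shows "card {k \<in> {1..<i}. \<sigma> k < \<sigma> i} = a i"
proof -
  have inj: "inj_on \<sigma> A" for A
    using permutes_inj[OF perm_of_code_permutes] inj_on_subset by blast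
  have "unused i = \<sigma> ` {1..n} - \<sigma> ` {i<..n}"
    unfolding permutes_image[OF perm_of_code_permutes] ..
  also have "\<dots> = \<sigma> ` ({1..n} - {i<..n})"
    by (rule image_set_diff[OF inj, symmetric])
  also have "{1..n} - {i<..n} = insert i {1..<i}"
    using i by auto
  finally have unused: "unused i = insert (\<sigma> i) (\<sigma> ` {1..<i})"
    by simp
  have "{x \<in> unused i. x < \<sigma> i} = \<sigma> ` {k \<in> {1..<i}. \<sigma> k < \<sigma> i}"
    unfolding unused by auto
  then have "card {k \<in> {1..<i}. \<sigma> k < \<sigma> i} = card {x \<in> unused i. x < \<sigma> i}"
    by (simp add: card_image[OF inj])
  also have "\<dots> = a i"
    using card_less_nth_sorted_list_of_set[of "unused i" "a i"] perm_of_code_aux[OF i(2)]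
      a[OF i] code_value[OF i] by simp
  finally show ?thesis .
qed

end

lemma card_occ_2_31:
  assumes perm: "\<sigma> permutes {1..n}"
    and rank: "\<And>i. 1 \<le> i \<Longrightarrow> i \<le> n \<Longrightarrow> card {k \<in> {1..<i}. \<sigma> k < \<sigma> i} = a i"
  shows "card (occ_2_31 n \<sigma>) = (\<Sum>j = 1..<n. a j - a (Suc j))"
proof -
  let ?O = "\<lambda>j. {i \<in> {1..<j}. \<sigma> (Suc j) < \<sigma> i \<and> \<sigma> i < \<sigma> j}"
  have "occ_2_31 n \<sigma> = prod.swap ` (SIGMA j:{1..<n}. ?O j)"
    by (force simp: occ_2_31_def)
  then have "card (occ_2_31 n \<sigma>) = (\<Sum>j = 1..<n. card (?O j))"
    by (simp add: card_image)
  also have "\<dots> = (\<Sum>j = 1..<n. a j - a (Suc j))"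
  proof (rule sum.cong[OF refl])
    fix j assume j: "j \<in> {1..<n}"
    have inj: "\<sigma> x = \<sigma> y \<longleftrightarrow> x = y" for x y
      using permutes_inj[OF perm] by (auto dest: injD)
    let ?L = "{k \<in> {1..<j}. \<sigma> k < \<sigma> (Suc j)}"
    show "card (?O j) = a j - a (Suc j)"
    proof (cases "\<sigma> (Suc j) < \<sigma> j")
      case True
      \<comment> \<open>A value that is not below \<open>\<sigma> (Suc j)\<close> is above it, by
        injectivity.\<close>
      have "?O j = {k \<in> {1..<j}. \<sigma> k < \<sigma> j} - ?L"
        using inj by (auto simp: not_less order_le_less)
      moreover have "?L \<subseteq> {k \<in> {1..<j}. \<sigma> k < \<sigma> j}"
        using True by auto
      \<comment> \<open>At a descent, position \<open>j\<close> itself does not count for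
        \<open>a (Suc j)\<close>.\<close>
      moreover have "{k \<in> {1..<Suc j}. \<sigma> k < \<sigma> (Suc j)} = ?L"
        using True by (auto simp: less_Suc_eq)
      ultimately show ?thesis
        using rank[of j] rank[of "Suc j"] j by (simp add: card_Diff_subset)
    next
      case False
      \<comment> \<open>At an ascent the code does not decrease, so the truncated difference is
        0.\<close>
      have "card {k \<in> {1..<j}. \<sigma> k < \<sigma> j} \<le> card {k \<in> {1..<Suc j}. \<sigma> k < \<sigma> (Suc j)}"
        using False by (intro card_mono) auto
      moreover have "?O j = {}"
        using False by auto
      ultimately show ?thesis
        using rank[of j] rank[of "Suc j"] j by simp
    qed
  qed
  finally show ?thesis .
qed

theorem theorem4p2:
  fixes n :: nat
  assumes "n \<ge> 1"
  shows "bij_betw Phi1 (TLT n) {\<sigma>. \<sigma> permutes {1..n}} \<and>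
         (\<forall>T \<in> TLT n. \<forall>\<sigma>. \<sigma> = Phi1 T \<longrightarrow> cr T = card (occ_2_31 n \<sigma>))"
proof -
  have Phi1: "Phi1 T = perm_of_code n (ins_index T)" if "T \<in> TLT n" for T
    using that by (simp add: Phi1_def TLT_def)
  have perm: "Phi1 T permutes {1..n}" if "T \<in> TLT n" for T
    unfolding Phi1[OF that]
    by (rule insertion_code.perm_of_code_permutes, unfold_locales) (rule ins_index_less[OF assms that])
  have rank: "card {k \<in> {1..<i}. Phi1 T k < Phi1 T i} = ins_index T i"
    if "T \<in> TLT n" "1 \<le> i" "i \<le> n" for T i
    unfolding Phi1[OF that(1)]
    by (rule insertion_code.perm_of_code_rank[OF _ that(2,3)], unfold_locales)
      (rule ins_index_less[OF assms that(1)])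
  have inj: "inj_on Phi1 (TLT n)"
  proof (rule inj_onI)
    fix T1 T2 assume T: "T1 \<in> TLT n" "T2 \<in> TLT n" and eq: "Phi1 T1 = Phi1 T2"
    show "T1 = T2"
      \<comment> \<open>The permutation determines the code, whose entries are its ranks.\<close>
      using ins_index_inj[OF assms T] rank[OF T(1)] rank[OF T(2)] eq by simp
  qed
  \<comment> \<open>Both sets have \<open>fact n\<close> elements, so the injective map is
    onto.\<close>
  have "card (Phi1 ` TLT n) = card {\<sigma>. \<sigma> permutes {1..n}}"
    using card_TLT[OF assms] card_permutations[of "{1..n}" n] by (simp add: card_image[OF inj])
  then have "Phi1 ` TLT n = {\<sigma>. \<sigma> permutes {1..n}}"
    using perm by (intro card_subset_eq) (auto simp: finite_permutations)
  with inj have "bij_betw Phi1 (TLT n) {\<sigma>. \<sigma> permutes {1..n}}"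
    by (simp add: bij_betw_def)
  moreover have "cr T = card (occ_2_31 n (Phi1 T))" if "T \<in> TLT n" for T
    using cr_eq_sum[OF assms that] card_occ_2_31[OF perm[OF that] rank[OF that]] by simp
  ultimately show ?thesis
    by blast
qed

end
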